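(* Let $\mathcal{C}$ be a class of $(\mathbb{T},V)$-spaces containing at least one non-empty space. Suppose that each element of $\mathcal{C}$ is exponentiable in $(\mathbb{T},V)\text{-}\mathsf{Cat}$ and that the product (in $(\mathbb{T},V)\text{-}\mathsf{Cat}$) of any two elements of $\mathcal{C}$ is a $\mathcal{C}$-generated space. Then the full subcategory $(\mathbb{T},V)\text{-}\mathsf{Cat}_{\mathcal{C}}$ of $(\mathbb{T},V)\text{-}\mathsf{Cat}$ consisting of the $\mathcal{C}$-generated spaces is a cartesian closed category.
   Context: Setting. $V=(V,\otimes,k)$ is a unital commutative quantale (a complete lattice with a commutative associative operation $\otimes$ with unit $k$ that preserves arbitrary suprema in each variable) which is also a Heyting algebra (each $u\wedge(-)$ has a right adjoint); $\bot,\top$ denote bottom and top. A $V$-relation $r\colon X\nrightarrow Y$ is a map $r\colon X\times Y\to V$; composition is $(s\cdot r)(x,z)=\bigvee_{y}r(x,y)\otimes s(y,z)$, the order is componentwise, and $r^{\circ}(y,x)=r(x,y)$. A map $f\colon X\to Y$ is regarded as the $V$-relation with $f(x,y)=k$ if $f(x)=y$ and $\bot$ otherwise. $\mathbb{T}=(T,m,e)$ is a monad on $\mathsf{Set}$ satisfying (BC): $T$ preserves weak pullbacks and the naturality squares of $m$ are weak pullbacks. A lax extension of $\mathbb{T}$ to $V$-relations is fixed, sending $r\colon X\nrightarrow Y$ to $Tr\colon TX\nrightarrow TY$: it is monotone, $Ts\cdot Tr\le T(s\cdot r)$, it is flat (the extension satisfies $T1_X=1_{TX}$, so that it agrees with $T$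 on maps), $T(r^{\circ})=(Tr)^{\circ}$, $e_Y\cdot r\le Tr\cdot e_X$ and $m_Y\cdot TTr\le Tr\cdot m_X$. A $(\mathbb{T},V)$-space is a pair $(X,a)$ with $a\colon TX\nrightarrow X$ a $V$-relation such that $1_X\le a\cdot e_X$ and $a\cdot Ta\le a\cdot m_X$. A map $f\colon(X,a)\to(Y,b)$ is $(\mathbb{T},V)$-continuous if $f\cdot a\le b\cdot Tf$, i.e. $a(\mathfrak{x},x)\le b(Tf(\mathfrak{x}),f(x))$ for all $\mathfrak{x}\in TX,x\in X$. These form the category $(\mathbb{T},V)\text{-}\mathsf{Cat}$, whose forgetful functor to $\mathsf{Set}$ is topological. Standing assumption: every constant map between $(\mathbb{T},V)$-spaces is continuous. A space $(X,a)$ is exponentiable if the functor $-\times(X,a)$ on $(\mathbb{T},V)\text{-}\mathsf{Cat}$ has a right adjoint. For a class $\mathcal{C}$ of spaces, a probe over $(X,a)$ is a continuous map $p\colon C\to(X,a)$ with $C\in\mathcal{C}$. The $\mathcal{C}$-generated structure $a^{c}$ on $X$ is the final structure with respect to all probes over $(X,a)$: the $(\mathbb{T},V)$-structure such that, for every space $(Y,b)$, a map $g\colon(X,a^{c})\to(Y,b)$ is continuous iff $g\cdot p$ is continuous for every probe $p$ over $(X,a)$. The space $(X,a)$ is $\mathcal{C}$-generated if $a=a^{c}$. *)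

theory Defs
  imports "HOL-Library.FuncSet" "HOL-Library.Equipollence"
begin

section \<open>Categories, functors, adjunctions, cartesian closedness\<close>

text \<open>Homs are indexed by objects and need not be disjoint. \<open>cmp C X Y Z g f\<close> is the
  composite of \<open>f : X \<rightarrow> Y\<close> followed by \<open>g : Y \<rightarrow> Z\<close>.\<close>

record ('o, 'a) cat =
  obj :: "'o set"
  hom :: "'o \<Rightarrow> 'o \<Rightarrow> 'a set"
  ide :: "'o \<Rightarrow> 'a"
  cmp :: "'o \<Rightarrow> 'o \<Rightarrow> 'o \<Rightarrow> 'a \<Rightarrow> 'a \<Rightarrow> 'a"

definition category :: "('o, 'a) cat \<Rightarrow> bool" where
  "category C \<longleftrightarrow>
    (\<forall>X\<in>obj C. ide C X \<in> hom C X X) \<and>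
    (\<forall>X\<in>obj C. \<forall>Y\<in>obj C. \<forall>Z\<in>obj C. \<forall>f\<in>hom C X Y. \<forall>g\<in>hom C Y Z.
      cmp C X Y Z g f \<in> hom C X Z) \<and>
    (\<forall>X\<in>obj C. \<forall>Y\<in>obj C. \<forall>f\<in>hom C X Y.
      cmp C X X Y f (ide C X) = f \<and> cmp C X Y Y (ide C Y) f = f) \<and>
    (\<forall>W\<in>obj C. \<forall>X\<in>obj C. \<forall>Y\<in>obj C. \<forall>Z\<in>obj C.
      \<forall>f\<in>hom C W X. \<forall>g\<in>hom C X Y. \<forall>h\<in>hom C Y Z.
      cmp C W X Z (cmp C X Y Z h g) f = cmp C W Y Z h (cmp C W X Y g f))"

definition full_subcat :: "('o, 'a) cat \<Rightarrow> ('o \<Rightarrow> bool) \<Rightarrow> ('o, 'a) cat" where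
  "full_subcat C P = C\<lparr>obj := {X \<in> obj C. P X}\<rparr>"

record ('o, 'a, 'p, 'b) fctr =
  fobj :: "'o \<Rightarrow> 'p"
  farr :: "'o \<Rightarrow> 'o \<Rightarrow> 'a \<Rightarrow> 'b"

definition is_functor ::
  "('o, 'a) cat \<Rightarrow> ('p, 'b) cat \<Rightarrow> ('o, 'a, 'p, 'b) fctr \<Rightarrow> bool" where
  "is_functor C D F \<longleftrightarrow>
    (\<forall>X\<in>obj C. fobj F X \<in> obj D) \<and>
    (\<forall>X\<in>obj C. \<forall>Y\<in>obj C. \<forall>f\<in>hom C X Y. farr F X Y f \<in> hom D (fobj F X) (fobj F Y)) \<and>
    (\<forall>X\<in>obj C. farr F X X (ide C X) = ide D (fobj F X)) \<and>
    (\<forall>X\<in>obj C. \<forall>Y\<in>obj C. \<forall>Z\<in>obj C. \<forall>f\<in>hom C X Y. \<forall>g\<in>hom C Y Z.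
      farr F X Z (cmp C X Y Z g f) =
        cmp D (fobj F X) (fobj F Y) (fobj F Z) (farr F Y Z g) (farr F X Y f))"

definition id_fctr :: "('o, 'a, 'o, 'a) fctr" where
  "id_fctr = \<lparr>fobj = (\<lambda>X. X), farr = (\<lambda>X Y f. f)\<rparr>"

definition comp_fctr ::
  "('p, 'b, 'q, 'c) fctr \<Rightarrow> ('o, 'a, 'p, 'b) fctr \<Rightarrow> ('o, 'a, 'q, 'c) fctr" where
  "comp_fctr G F =
    \<lparr>fobj = (\<lambda>X. fobj G (fobj F X)),
     farr = (\<lambda>X Y f. farr G (fobj F X) (fobj F Y) (farr F X Y f))\<rparr>"

definition nat_trans ::
  "('o, 'a) cat \<Rightarrow> ('p, 'b) cat \<Rightarrow> ('o, 'a, 'p, 'b) fctr \<Rightarrow> ('o, 'a, 'p, 'b) fctr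
    \<Rightarrow> ('o \<Rightarrow> 'b) \<Rightarrow> bool" where
  "nat_trans C D F G t \<longleftrightarrow>
    (\<forall>X\<in>obj C. t X \<in> hom D (fobj F X) (fobj G X)) \<and>
    (\<forall>X\<in>obj C. \<forall>Y\<in>obj C. \<forall>f\<in>hom C X Y.
      cmp D (fobj F X) (fobj F Y) (fobj G Y) (t Y) (farr F X Y f) =
      cmp D (fobj F X) (fobj G X) (fobj G Y) (farr G X Y f) (t X))"

definition is_monad ::
  "('o, 'a) cat \<Rightarrow> ('o, 'a, 'o, 'a) fctr \<Rightarrow> ('o \<Rightarrow> 'a) \<Rightarrow> ('o \<Rightarrow> 'a) \<Rightarrow> bool" where
  "is_monad C T m e \<longleftrightarrow>
    is_functor C C T \<and>
    nat_trans C C (comp_fctr T T) T m \<and>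
    nat_trans C C id_fctr T e \<and>
    (\<forall>X\<in>obj C.
      (let TX = fobj T X; TTX = fobj T TX; TTTX = fobj T TTX in
        cmp C TX TTX TX (m X) (e TX) = ide C TX \<and>
        cmp C TX TTX TX (m X) (farr T X TX (e X)) = ide C TX \<and>
        cmp C TTTX TTX TX (m X) (m TX) = cmp C TTTX TTX TX (m X) (farr T TTX TX (m X))))"

text \<open>The square \<open>f \<circ> p = g \<circ> q\<close> with \<open>p : P \<rightarrow> X\<close>, \<open>q : P \<rightarrow> Y\<close>, \<open>f : X \<rightarrow> Z\<close>, \<open>g : Y \<rightarrow> Z\<close>.\<close>

definition weak_pullback ::
  "('o, 'a) cat \<Rightarrow> 'o \<Rightarrow> 'o \<Rightarrow> 'o \<Rightarrow> 'o \<Rightarrow> 'a \<Rightarrow> 'a \<Rightarrow> 'a \<Rightarrow> 'a \<Rightarrow> bool" where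
  "weak_pullback C P X Y Z p q f g \<longleftrightarrow>
    P \<in> obj C \<and> X \<in> obj C \<and> Y \<in> obj C \<and> Z \<in> obj C \<and>
    p \<in> hom C P X \<and> q \<in> hom C P Y \<and> f \<in> hom C X Z \<and> g \<in> hom C Y Z \<and>
    cmp C P X Z f p = cmp C P Y Z g q \<and>
    (\<forall>W\<in>obj C. \<forall>u\<in>hom C W X. \<forall>v\<in>hom C W Y.
      cmp C W X Z f u = cmp C W Y Z g v \<longrightarrow>
      (\<exists>h\<in>hom C W P. cmp C W P X p h = u \<and> cmp C W P Y q h = v))"

definition is_terminal :: "('o, 'a) cat \<Rightarrow> 'o \<Rightarrow> bool" where
  "is_terminal C I \<longleftrightarrow> I \<in> obj C \<and> (\<forall>X\<in>obj C. \<exists>!f. f \<in> hom C X I)"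

definition is_product :: "('o, 'a) cat \<Rightarrow> 'o \<Rightarrow> 'o \<Rightarrow> 'o \<Rightarrow> 'a \<Rightarrow> 'a \<Rightarrow> bool" where
  "is_product C X Y P p q \<longleftrightarrow>
    X \<in> obj C \<and> Y \<in> obj C \<and> P \<in> obj C \<and> p \<in> hom C P X \<and> q \<in> hom C P Y \<and>
    (\<forall>Z\<in>obj C. \<forall>f\<in>hom C Z X. \<forall>g\<in>hom C Z Y.
      \<exists>!h. h \<in> hom C Z P \<and> cmp C Z P X p h = f \<and> cmp C Z P Y q h = g)"

text \<open>\<open>F\<close> is the functor \<open>- \<times> X\<close> with respect to the chosen products
  \<open>(F Y, p Y : F Y \<rightarrow> Y, q Y : F Y \<rightarrow> X)\<close>.\<close>

definition is_product_fctr ::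
  "('o, 'a) cat \<Rightarrow> 'o \<Rightarrow> ('o, 'a, 'o, 'a) fctr \<Rightarrow> ('o \<Rightarrow> 'a) \<Rightarrow> ('o \<Rightarrow> 'a) \<Rightarrow> bool" where
  "is_product_fctr C X F p q \<longleftrightarrow>
    (\<forall>Y\<in>obj C. is_product C Y X (fobj F Y) (p Y) (q Y)) \<and>
    (\<forall>Y\<in>obj C. \<forall>Z\<in>obj C. \<forall>f\<in>hom C Y Z.
      farr F Y Z f \<in> hom C (fobj F Y) (fobj F Z) \<and>
      cmp C (fobj F Y) (fobj F Z) Z (p Z) (farr F Y Z f) = cmp C (fobj F Y) Y Z f (p Y) \<and>
      cmp C (fobj F Y) (fobj F Z) X (q Z) (farr F Y Z f) = q Y)"

text \<open>\<open>G\<close> is right adjoint to \<open>F\<close>: bijections \<open>D(F X, Y) \<cong> C(X, G Y)\<close>, natural in \<open>X\<close> and \<open>Y\<close>.\<close>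

definition is_right_adjoint ::
  "('o, 'a) cat \<Rightarrow> ('p, 'b) cat \<Rightarrow> ('o, 'a, 'p, 'b) fctr \<Rightarrow> ('p, 'b, 'o, 'a) fctr \<Rightarrow> bool" where
  "is_right_adjoint C D F G \<longleftrightarrow>
    is_functor C D F \<and> is_functor D C G \<and>
    (\<exists>\<phi> :: 'o \<Rightarrow> 'p \<Rightarrow> 'b \<Rightarrow> 'a.
      (\<forall>X\<in>obj C. \<forall>Y\<in>obj D. bij_betw (\<phi> X Y) (hom D (fobj F X) Y) (hom C X (fobj G Y))) \<and>
      (\<forall>X\<in>obj C. \<forall>X'\<in>obj C. \<forall>Y\<in>obj D. \<forall>Y'\<in>obj D.
        \<forall>f\<in>hom C X' X. \<forall>g\<in>hom D Y Y'. \<forall>h\<in>hom D (fobj F X) Y.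
        \<phi> X' Y' (cmp D (fobj F X') Y Y' g (cmp D (fobj F X') (fobj F X) Y h (farr F X' X f))) =
        cmp C X' (fobj G Y) (fobj G Y') (farr G Y Y' g)
          (cmp C X' X (fobj G Y) (\<phi> X Y h) f)))"

definition exponentiable :: "('o, 'a) cat \<Rightarrow> 'o \<Rightarrow> bool" where
  "exponentiable C X \<longleftrightarrow>
    X \<in> obj C \<and> (\<exists>F p q G. is_product_fctr C X F p q \<and> is_right_adjoint C C F G)"

definition cartesian_closed :: "('o, 'a) cat \<Rightarrow> bool" where
  "cartesian_closed C \<longleftrightarrow>
    category C \<and>
    (\<exists>I. is_terminal C I) \<and>
    (\<forall>X\<in>obj C. \<forall>Y\<in>obj C. \<exists>P p q. is_product C X Y P p q) \<and>
    (\<forall>X\<in>obj C. exponentiable C X)"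


section \<open>The category of sets\<close>

text \<open>HOL cannot quantify over monads on the category of all sets, so \<open>Set\<close> is the category of
  the small subsets of a universe type, where a subset is small if it has fewer elements than the
  type. The cardinality of the type has to be an infinite strong limit, which makes small sets
  closed under subsets, finite products, power sets and function sets. Strongly inaccessible
  cardinalities, i.e. Grothendieck universes, are a special case.\<close>

class set_universe =
  assumes infinite_universe: "infinite (UNIV :: 'a set)"
    and strong_limit_universe:
      "(A :: 'a set) \<prec> (UNIV :: 'a set) \<Longrightarrow> Pow A \<prec> (UNIV :: 'a set)"

instance nat :: set_universe
proof
  show "infinite (UNIV :: nat set)" by simp
  fix A :: "nat set" assume "A \<prec> (UNIV :: nat set)"
  then have "finite A"
    by (meson infinite_le_lepoll lepoll_antisym lesspoll_def)
  then show "Pow A \<prec> (UNIV :: nat set)"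
    by (simp add: finite_lesspoll_infinite)
qed

definition small :: "'u::set_universe set \<Rightarrow> bool" where
  "small X \<longleftrightarrow> X \<prec> (UNIV :: 'u set)"

definition Set_cat :: "('u::set_universe set, 'u \<Rightarrow> 'u) cat" where
  "Set_cat =
    \<lparr>obj = {X. small X},
     hom = (\<lambda>X Y. X \<rightarrow>\<^sub>E Y),
     ide = (\<lambda>X. restrict id X),
     cmp = (\<lambda>X Y Z g f. compose X g f)\<rparr>"

definition BC :: "('u::set_universe set, 'u \<Rightarrow> 'u, 'u set, 'u \<Rightarrow> 'u) fctr
    \<Rightarrow> ('u set \<Rightarrow> 'u \<Rightarrow> 'u) \<Rightarrow> bool" where
  "BC T m \<longleftrightarrow>
    (\<forall>P X Y Z p q f g. weak_pullback Set_cat P X Y Z p q f g \<longrightarrow>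
      weak_pullback Set_cat (fobj T P) (fobj T X) (fobj T Y) (fobj T Z)
        (farr T P X p) (farr T P Y q) (farr T X Z f) (farr T Y Z g)) \<and>
    (\<forall>X\<in>obj Set_cat. \<forall>Y\<in>obj Set_cat. \<forall>f\<in>hom Set_cat X Y.
      weak_pullback Set_cat
        (fobj T (fobj T X)) (fobj T X) (fobj T (fobj T Y)) (fobj T Y)
        (m X) (farr T (fobj T X) (fobj T Y) (farr T X Y f)) (farr T X Y f) (m Y))"


section \<open>Quantales and quantale-valued relations\<close>

text \<open>The tensor is \<open>*\<close> and its unit is \<open>1\<close>. Preservation of suprema in the first variable
  follows by commutativity.\<close>

class comm_quantale = complete_lattice + comm_monoid_mult +
  assumes mult_Sup: "u * Sup A = (SUP v\<in>A. u * v)"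

class heyting_quantale = comm_quantale +
  assumes inf_right_adjoint: "\<exists>h. \<forall>v w. inf u v \<le> w \<longleftrightarrow> v \<le> h w"

text \<open>A \<open>V\<close>-relation from \<open>X\<close> to \<open>Y\<close> is represented by the function on the universe that extends
  it by \<open>bot\<close>. As \<open>bot\<close> is absorbing for \<open>*\<close>, the supremum in the composite may range over the
  whole type, and the pointwise order on functions is the order of relations.\<close>

definition vrel :: "'u set \<Rightarrow> 'u set \<Rightarrow> ('u \<Rightarrow> 'u \<Rightarrow> 'v::heyting_quantale) set" where
  "vrel X Y = {r. \<forall>x y. x \<notin> X \<or> y \<notin> Y \<longrightarrow> r x y = bot}"

definition vcomp :: "('u \<Rightarrow> 'u \<Rightarrow> 'v::heyting_quantale) \<Rightarrow> ('u \<Rightarrow> 'u \<Rightarrow> 'v) \<Rightarrow> 'u \<Rightarrow> 'u \<Rightarrow> 'v"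
    (infixr "\<cdot>\<^sub>v" 70) where
  "s \<cdot>\<^sub>v r = (\<lambda>x z. SUP y. r x y * s y z)"

definition vconv :: "('u \<Rightarrow> 'u \<Rightarrow> 'v::heyting_quantale) \<Rightarrow> 'u \<Rightarrow> 'u \<Rightarrow> 'v" where
  "vconv r = (\<lambda>y x. r x y)"

definition vgraph :: "'u set \<Rightarrow> ('u \<Rightarrow> 'u) \<Rightarrow> 'u \<Rightarrow> 'u \<Rightarrow> 'v::heyting_quantale" where
  "vgraph X f = (\<lambda>x y. if x \<in> X \<and> f x = y then 1 else bot)"


section \<open>Lax extensions and \<open>(\<T>, V)\<close>-spaces\<close>

text \<open>\<open>ext t X Y r\<close> is the extension \<open>T r\<close> of the \<open>V\<close>-relation \<open>r\<close> from \<open>X\<close> to \<open>Y\<close>.\<close>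

record ('u, 'v) tv_data =
  fct :: "('u set, 'u \<Rightarrow> 'u, 'u set, 'u \<Rightarrow> 'u) fctr"
  mul :: "'u set \<Rightarrow> 'u \<Rightarrow> 'u"
  unt :: "'u set \<Rightarrow> 'u \<Rightarrow> 'u"
  ext :: "'u set \<Rightarrow> 'u set \<Rightarrow> ('u \<Rightarrow> 'u \<Rightarrow> 'v) \<Rightarrow> 'u \<Rightarrow> 'u \<Rightarrow> 'v"

abbreviation TO :: "('u, 'v) tv_data \<Rightarrow> 'u set \<Rightarrow> 'u set" where
  "TO t \<equiv> fobj (fct t)"

abbreviation TA :: "('u, 'v) tv_data \<Rightarrow> 'u set \<Rightarrow> 'u set \<Rightarrow> ('u \<Rightarrow> 'u) \<Rightarrow> 'u \<Rightarrow> 'u" where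
  "TA t \<equiv> farr (fct t)"

definition flat_lax_extension :: "('u::set_universe, 'v::heyting_quantale) tv_data \<Rightarrow> bool" where
  "flat_lax_extension t \<longleftrightarrow>
    (\<forall>X Y. small X \<longrightarrow> small Y \<longrightarrow> (\<forall>r\<in>vrel X Y.
      ext t X Y r \<in> vrel (TO t X) (TO t Y) \<and>
      (\<forall>s\<in>vrel X Y. r \<le> s \<longrightarrow> ext t X Y r \<le> ext t X Y s) \<and>
      ext t Y X (vconv r) = vconv (ext t X Y r) \<and>
      vgraph Y (unt t Y) \<cdot>\<^sub>v r \<le> ext t X Y r \<cdot>\<^sub>v vgraph X (unt t X) \<and>
      vgraph (TO t (TO t Y)) (mul t Y) \<cdot>\<^sub>v ext t (TO t X) (TO t Y) (ext t X Y r)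
        \<le> ext t X Y r \<cdot>\<^sub>v vgraph (TO t (TO t X)) (mul t X))) \<and>
    (\<forall>X Y Z. small X \<longrightarrow> small Y \<longrightarrow> small Z \<longrightarrow> (\<forall>r\<in>vrel X Y. \<forall>s\<in>vrel Y Z.
      ext t Y Z s \<cdot>\<^sub>v ext t X Y r \<le> ext t X Z (s \<cdot>\<^sub>v r))) \<and>
    (\<forall>X. small X \<longrightarrow> ext t X X (vgraph X id) = vgraph (TO t X) id) \<and>
    (\<forall>X Y. small X \<longrightarrow> small Y \<longrightarrow> (\<forall>f\<in>X \<rightarrow>\<^sub>E Y.
      ext t X Y (vgraph X f) = vgraph (TO t X) (TA t X Y f)))"

definition tv_space ::
  "('u::set_universe, 'v::heyting_quantale) tv_data \<Rightarrow> 'u set \<times> ('u \<Rightarrow> 'u \<Rightarrow> 'v) \<Rightarrow> bool" where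
  "tv_space t = (\<lambda>(X, a).
    small X \<and> a \<in> vrel (TO t X) X \<and>
    vgraph X id \<le> a \<cdot>\<^sub>v vgraph X (unt t X) \<and>
    a \<cdot>\<^sub>v ext t (TO t X) X a \<le> a \<cdot>\<^sub>v vgraph (TO t (TO t X)) (mul t X))"

definition tv_continuous ::
  "('u::set_universe, 'v::heyting_quantale) tv_data \<Rightarrow> 'u set \<times> ('u \<Rightarrow> 'u \<Rightarrow> 'v)
    \<Rightarrow> 'u set \<times> ('u \<Rightarrow> 'u \<Rightarrow> 'v) \<Rightarrow> ('u \<Rightarrow> 'u) \<Rightarrow> bool" where
  "tv_continuous t = (\<lambda>(X, a) (Y, b) f.
    f \<in> X \<rightarrow>\<^sub>E Y \<and> vgraph X f \<cdot>\<^sub>v a \<le> b \<cdot>\<^sub>v vgraph (TO t X) (TA t X Y f))"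

definition TV_Cat :: "('u::set_universe, 'v::heyting_quantale) tv_data
    \<Rightarrow> ('u set \<times> ('u \<Rightarrow> 'u \<Rightarrow> 'v), 'u \<Rightarrow> 'u) cat" where
  "TV_Cat t =
    \<lparr>obj = {A. tv_space t A},
     hom = (\<lambda>A B. {f. tv_continuous t A B f}),
     ide = (\<lambda>A. restrict id (fst A)),
     cmp = (\<lambda>A B C g f. compose (fst A) g f)\<rparr>"

definition constants_continuous ::
  "('u::set_universe, 'v::heyting_quantale) tv_data \<Rightarrow> bool" where
  "constants_continuous t \<longleftrightarrow>
    (\<forall>A B. tv_space t A \<longrightarrow> tv_space t B \<longrightarrow>
      (\<forall>y\<in>fst B. tv_continuous t A B (\<lambda>x\<in>fst A. y)))"

definition tv_setting :: "('u::set_universe, 'v::heyting_quantale) tv_data \<Rightarrow> bool" where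
  "tv_setting t \<longleftrightarrow>
    is_monad Set_cat (fct t) (mul t) (unt t) \<and>
    BC (fct t) (mul t) \<and>
    flat_lax_extension t \<and>
    constants_continuous t"


section \<open>\<open>\<C>\<close>-generated spaces\<close>

definition probe ::
  "('u::set_universe, 'v::heyting_quantale) tv_data \<Rightarrow> ('u set \<times> ('u \<Rightarrow> 'u \<Rightarrow> 'v)) set
    \<Rightarrow> 'u set \<times> ('u \<Rightarrow> 'u \<Rightarrow> 'v) \<Rightarrow> 'u set \<times> ('u \<Rightarrow> 'u \<Rightarrow> 'v) \<Rightarrow> ('u \<Rightarrow> 'u) \<Rightarrow> bool" where
  "probe t \<C> A D p \<longleftrightarrow> D \<in> \<C> \<and> tv_continuous t D A p"

text \<open>\<open>c\<close> is the final structure on the underlying set of \<open>A\<close> with respect to all probes over \<open>A\<close>.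
  There is at most one such \<open>c\<close>, so that being \<open>\<C>\<close>-generated means that the structure of \<open>A\<close>
  is this final structure.\<close>

definition generated_structure ::
  "('u::set_universe, 'v::heyting_quantale) tv_data \<Rightarrow> ('u set \<times> ('u \<Rightarrow> 'u \<Rightarrow> 'v)) set
    \<Rightarrow> 'u set \<times> ('u \<Rightarrow> 'u \<Rightarrow> 'v) \<Rightarrow> ('u \<Rightarrow> 'u \<Rightarrow> 'v) \<Rightarrow> bool" where
  "generated_structure t \<C> A c \<longleftrightarrow>
    tv_space t (fst A, c) \<and>
    (\<forall>B. tv_space t B \<longrightarrow> (\<forall>g\<in>fst A \<rightarrow>\<^sub>E fst B.
      tv_continuous t (fst A, c) B g \<longleftrightarrow>
      (\<forall>D p. probe t \<C> A D p \<longrightarrow> tv_continuous t D B (compose (fst D) g p))))"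

definition generated ::
  "('u::set_universe, 'v::heyting_quantale) tv_data \<Rightarrow> ('u set \<times> ('u \<Rightarrow> 'u \<Rightarrow> 'v)) set
    \<Rightarrow> 'u set \<times> ('u \<Rightarrow> 'u \<Rightarrow> 'v) \<Rightarrow> bool" where
  "generated t \<C> A \<longleftrightarrow> tv_space t A \<and> generated_structure t \<C> A (snd A)"

end

theory Submission
  imports Defs
begin

text \<open>
  The argument is the classical one for compactly generated spaces, in the form that works in any
  topological category over sets in which constant maps are continuous. The specific structure of
  \<open>(\<T>, V)\<close>-spaces enters only through the existence of initial structures (\<open>cont_init_iff\<close>): the
  pointwise infimum of the structures pulled back along a source is again a structure, because a
  lax extension turns continuity of \<open>g\<close> into the corresponding inequality for \<open>T g\<close>. Initial
  structures yield products and, for each space \<open>A\<close>, the final structure for its probes; the resulting space \<open>coref A\<close> has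
  the same probes as \<open>A\<close>, and \<open>coref\<close> is the coreflector onto the generated spaces.

  The product of generated spaces is therefore \<open>coref (A \<otimes> X)\<close>, and the exponential has to be
  \<open>coref (fun_space X Y)\<close> for a suitable structure on the set of continuous maps from \<open>X\<close> to \<open>Y\<close>.
  Every probe \<open>p : D \<rightarrow> X\<close> restricts a continuous map \<open>X \<rightarrow> Y\<close> to a continuous map \<open>D \<rightarrow> Y\<close>, that
  is, to a point of the exponential of \<open>Y\<close> by \<open>D\<close>, which exists as \<open>D\<close> is exponentiable.
  \<open>fun_space X Y\<close> carries the initial structure for all these restrictions. Hence
  a map \<open>Z \<rightarrow> fun_space X Y\<close> is continuous iff all its uncurried restrictions \<open>Z \<otimes> D \<rightarrow> Y\<close> are
  (\<open>cont_fun_space_iff\<close>).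

  The heart of the proof is \<open>cont_curry_iff\<close>: currying is a bijection between continuous maps
  \<open>coref (A \<otimes> X) \<rightarrow> Y\<close> and \<open>A \<rightarrow> fun_space X Y\<close>. Continuity of the curried map is tested on probes
  \<open>D' \<rightarrow> A\<close> and \<open>D \<rightarrow> X\<close>; together they give \<open>D' \<otimes> D \<rightarrow> A \<otimes> X\<close>, which lifts to the coreflection
  because \<open>D' \<otimes> D\<close> is generated. Continuity of the uncurried map is tested on probes
  \<open>D \<rightarrow> A \<otimes> X\<close>; both components are probes on the same \<open>D\<close>, so one obtains a continuous map
  on \<open>D \<otimes> D\<close> and restricts it to the diagonal.
\<close>

section \<open>Small sets, pairs and codes of functions\<close>

lemma small_subset: "small A \<Longrightarrow> B \<subseteq> A \<Longrightarrow> small B"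
  unfolding small_def by (meson lesspoll_trans1 subset_imp_lepoll)

lemma small_lepoll: "A \<prec> (UNIV :: 'u::set_universe set) \<Longrightarrow> small (f ` A :: 'u set)"
  unfolding small_def by (meson image_lepoll lesspoll_trans1)

lemma small_singleton: "small {u}"
  unfolding small_def by (rule finite_lesspoll_infinite) (simp_all add: infinite_universe)

lemma infinite_Times_self_eqpoll: "infinite A \<Longrightarrow> A \<times> A \<approx> A"
  unfolding eqpoll_iff_card_of_ordIso by (rule card_of_Times_same_infinite)

lemma lepoll_total: "A \<lesssim> B \<or> B \<lesssim> A"
  unfolding lepoll_def card_of_ordLeq by (rule ordLeq_total[OF card_of_Well_order card_of_Well_order])

text \<open>As the universe is infinite, one injective pairing function serves all sets at once, so that
  products of small sets are again sets of elements of the universe.\<close>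

definition pr :: "'u::set_universe \<Rightarrow> 'u \<Rightarrow> 'u" where
  "pr = curry (SOME c. inj c)"

definition pr1 :: "'u::set_universe \<Rightarrow> 'u" where
  "pr1 w = fst (inv (case_prod pr) w)"

definition pr2 :: "'u::set_universe \<Rightarrow> 'u" where
  "pr2 w = snd (inv (case_prod pr) w)"

lemma inj_pr: "inj (case_prod pr :: 'u::set_universe \<times> 'u \<Rightarrow> 'u)"
proof -
  have "(UNIV :: 'u set) \<times> (UNIV :: 'u set) \<approx> (UNIV :: 'u set)"
    by (rule infinite_Times_self_eqpoll) (rule infinite_universe)
  then have "\<exists>c :: 'u \<times> 'u \<Rightarrow> 'u. inj c"
    unfolding eqpoll_def bij_betw_def by auto
  from someI_ex[OF this] show ?thesis
    unfolding pr_def by simp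
qed

lemma pr1_pr [simp]: "pr1 (pr x y) = x"
  using inv_f_f[OF inj_pr, of "(x, y)"] by (simp add: pr1_def)

lemma pr2_pr [simp]: "pr2 (pr x y) = y"
  using inv_f_f[OF inj_pr, of "(x, y)"] by (simp add: pr2_def)

lemma small_Times_lesspoll:
  fixes X Y :: "'u::set_universe set"
  assumes "small X" "small Y"
  shows "X \<times> Y \<prec> (UNIV :: 'u set)"
proof -
  have *: "X \<times> Y \<prec> (UNIV :: 'u set)" if "small Y" "X \<lesssim> Y" for X Y :: "'u set"
  proof (cases "finite Y")
    case True
    then have "finite X"
      using that(2) by (meson lepoll_def inj_on_finite)
    with True show ?thesis
      by (simp add: finite_lesspoll_infinite infinite_universe)
  next
    case False
    have "X \<times> Y \<lesssim> Y \<times> Y"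
      using that(2) by (intro times_lepoll_mono) auto
    also have "Y \<times> Y \<approx> Y"
      using False by (rule infinite_Times_self_eqpoll)
    finally show ?thesis
      using that(1) unfolding small_def by (meson lesspoll_trans1)
  qed
  show ?thesis
    using *[OF assms(2)] *[OF assms(1)] lepoll_total[of X Y] times_commute_eqpoll[of X Y]
    by (meson eq_lesspoll_trans)
qed

definition pairs :: "'u::set_universe set \<Rightarrow> 'u set \<Rightarrow> 'u set" where
  "pairs X Y = case_prod pr ` (X \<times> Y)"

lemma pairsE:
  assumes "w \<in> pairs X Y"
  obtains x y where "x \<in> X" "y \<in> Y" "w = pr x y"
  using assms by (auto simp: pairs_def)

lemma pr_in_pairs [simp]: "pr x y \<in> pairs X Y \<longleftrightarrow> x \<in> X \<and> y \<in> Y"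
proof
  assume "pr x y \<in> pairs X Y"
  then obtain x' y' where "x' \<in> X" "y' \<in> Y" "pr x y = pr x' y'" by (rule pairsE)
  then show "x \<in> X \<and> y \<in> Y" by (metis pr1_pr pr2_pr)
qed (auto simp: pairs_def)

lemma small_pairs: "small X \<Longrightarrow> small Y \<Longrightarrow> small (pairs X Y)"
  unfolding pairs_def by (intro small_lepoll small_Times_lesspoll)

text \<open>The graph of a function is a subset of the small set of pairs, and power sets of small sets
  are small because the universe is a strong limit.\<close>

lemma funset_lesspoll:
  fixes X Y :: "'u::set_universe set"
  assumes "small X" "small Y"
  shows "(X \<rightarrow>\<^sub>E Y) \<prec> (UNIV :: 'u set)"
proof -
  have "inj_on (\<lambda>f. (\<lambda>x. pr x (f x)) ` X) (X \<rightarrow>\<^sub>E Y)"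
  proof (rule inj_onI)
    fix f g assume f: "f \<in> X \<rightarrow>\<^sub>E Y" and g: "g \<in> X \<rightarrow>\<^sub>E Y"
      and eq: "(\<lambda>x. pr x (f x)) ` X = (\<lambda>x. pr x (g x)) ` X"
    show "f = g"
    proof (rule PiE_ext[OF f g])
      fix x assume "x \<in> X"
      then have "pr x (f x) \<in> (\<lambda>x. pr x (g x)) ` X" using eq by blast
      then obtain x' where "pr x (f x) = pr x' (g x')" by blast
      then show "f x = g x" by (metis pr1_pr pr2_pr)
    qed
  qed
  moreover have "(\<lambda>f. (\<lambda>x. pr x (f x)) ` X) ` (X \<rightarrow>\<^sub>E Y) \<subseteq> Pow (pairs X Y)"
    by (auto dest: PiE_mem)
  ultimately have "(X \<rightarrow>\<^sub>E Y) \<lesssim> Pow (pairs X Y)"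
    unfolding lepoll_def by blast
  also have "Pow (pairs X Y) \<prec> (UNIV :: 'u set)"
    using small_pairs[OF assms] unfolding small_def by (rule strong_limit_universe)
  finally show ?thesis .
qed

text \<open>A code names a function by an element of the universe, which is what makes a set of functions
  the underlying set of a space. Only the values on \<open>X\<close> matter.\<close>

definition code :: "'u::set_universe set \<Rightarrow> 'u set \<Rightarrow> ('u \<Rightarrow> 'u) \<Rightarrow> 'u" where
  "code X Y h = (SOME c. inj_on c (X \<rightarrow>\<^sub>E Y)) (restrict h X)"

definition decode :: "'u::set_universe set \<Rightarrow> 'u set \<Rightarrow> 'u \<Rightarrow> 'u \<Rightarrow> 'u" where
  "decode X Y = inv_into (X \<rightarrow>\<^sub>E Y) (code X Y)"

lemma code_cong: "(\<And>x. x \<in> X \<Longrightarrow> h x = h' x) \<Longrightarrow> code X Y h = code X Y h'"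
  unfolding code_def by (simp cong: restrict_cong)

lemma inj_on_code:
  assumes "small X" "small Y"
  shows "inj_on (code X Y) (X \<rightarrow>\<^sub>E Y)"
proof -
  have "\<exists>c :: ('a \<Rightarrow> 'a) \<Rightarrow> 'a. inj_on c (X \<rightarrow>\<^sub>E Y)"
    using lesspoll_imp_lepoll[OF funset_lesspoll[OF assms]] unfolding lepoll_def by blast
  then have "inj_on (SOME c :: ('a \<Rightarrow> 'a) \<Rightarrow> 'a. inj_on c (X \<rightarrow>\<^sub>E Y)) (X \<rightarrow>\<^sub>E Y)"
    by (rule someI_ex)
  moreover have "code X Y h = (SOME c. inj_on c (X \<rightarrow>\<^sub>E Y)) h" if "h \<in> X \<rightarrow>\<^sub>E Y" for h
    unfolding code_def PiE_restrict[OF that] by (rule refl)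
  ultimately show ?thesis
    by (simp cong: inj_on_cong)
qed

lemma decode_code:
  assumes "small X" "small Y" "\<And>x. x \<in> X \<Longrightarrow> h x \<in> Y" "x \<in> X"
  shows "decode X Y (code X Y h) x = h x"
proof -
  have "restrict h X \<in> X \<rightarrow>\<^sub>E Y" using assms(3) by auto
  moreover have "code X Y h = code X Y (restrict h X)" by (rule code_cong) simp
  ultimately have "decode X Y (code X Y h) = restrict h X"
    unfolding decode_def using inj_on_code[OF assms(1,2)] by simp
  then show ?thesis using assms(4) by simp
qed


section \<open>Quantale-valued relations\<close>

lemma mult_bot_right [simp]: "u * bot = (bot :: 'v::comm_quantale)"
  using mult_Sup[of u "{}"] by simp

lemma mult_bot_left [simp]: "bot * u = (bot :: 'v::comm_quantale)"
  by (metis mult_bot_right mult.commute)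

lemma quantale_mult_left_mono:
  assumes "v \<le> w"
  shows "u * v \<le> u * (w :: 'v::comm_quantale)"
proof -
  have "u * v \<le> (SUP x\<in>{v, w}. u * x)"
    by (rule SUP_upper) simp
  also have "\<dots> = u * Sup {v, w}"
    by (rule mult_Sup[symmetric])
  also have "Sup {v, w} = w"
    using assms by (simp add: sup_absorb2)
  finally show ?thesis .
qed

lemma quantale_mult_mono: "v \<le> w \<Longrightarrow> v' \<le> w' \<Longrightarrow> v * v' \<le> w * (w' :: 'v::comm_quantale)"
  by (metis mult.commute order_trans quantale_mult_left_mono)

lemma vcomp_upper: "r x y * s y z \<le> (s \<cdot>\<^sub>v r) x z"
  unfolding vcomp_def by (rule SUP_upper) simp

lemma vcomp_le_iff: "s \<cdot>\<^sub>v r \<le> q \<longleftrightarrow> (\<forall>x y z. r x y * s y z \<le> q x z)"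
  unfolding vcomp_def le_fun_def by (auto simp: SUP_le_iff)

lemma vcomp_vgraph: "(s \<cdot>\<^sub>v vgraph X f) x z = (if x \<in> X then s (f x) z else bot)"
proof -
  have "(s \<cdot>\<^sub>v vgraph X f) x z = (SUP y. if x \<in> X \<and> f x = y then s y z else bot)"
    unfolding vcomp_def vgraph_def by (intro SUP_cong) auto
  also have "\<dots> = (if x \<in> X then s (f x) z else bot)"
  proof (rule antisym)
    show "(if x \<in> X then s (f x) z else bot)
        \<le> (SUP y. if x \<in> X \<and> f x = y then s y z else bot)"
      by (rule SUP_upper2[of "f x"]) auto
  qed (rule SUP_least, auto)
  finally show ?thesis .
qed

lemma vgraph_vcomp_le_iff:
  "vgraph X f \<cdot>\<^sub>v r \<le> q \<longleftrightarrow> (\<forall>x. \<forall>y\<in>X. r x y \<le> q x (f y))"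
  unfolding vcomp_le_iff vgraph_def by auto

lemma vgraph_in_vrel: "f \<in> X \<rightarrow> Y \<Longrightarrow> vgraph X f \<in> vrel X Y"
  unfolding vrel_def vgraph_def by auto

lemma vcomp_in_vrel:
  assumes "r \<in> vrel X Y" "s \<in> vrel Y Z"
  shows "s \<cdot>\<^sub>v r \<in> vrel X Z"
  using assms unfolding vrel_def vcomp_def by auto

lemma vconv_in_vrel: "r \<in> vrel X Y \<Longrightarrow> vconv r \<in> vrel Y X"
  unfolding vrel_def vconv_def by auto


section \<open>Monads with a flat lax extension\<close>

locale tv =
  fixes t :: "('u::set_universe, 'v::heyting_quantale) tv_data"
  assumes setting: "tv_setting t"
begin

lemma monad: "is_monad Set_cat (fct t) (mul t) (unt t)"
  using setting unfolding tv_setting_def by (rule conjunct1)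

lemma functor_T: "is_functor Set_cat Set_cat (fct t)"
  using monad unfolding is_monad_def by (rule conjunct1)

lemma small_TO: "small X \<Longrightarrow> small (TO t X)"
  using functor_T unfolding is_functor_def Set_cat_def by simp

lemma TA_PiE: "small X \<Longrightarrow> small Y \<Longrightarrow> f \<in> X \<rightarrow>\<^sub>E Y \<Longrightarrow> TA t X Y f \<in> TO t X \<rightarrow>\<^sub>E TO t Y"
  using functor_T unfolding is_functor_def Set_cat_def by simp

lemma TA_in:
  "small X \<Longrightarrow> small Y \<Longrightarrow> f \<in> X \<rightarrow>\<^sub>E Y \<Longrightarrow> \<xi> \<in> TO t X \<Longrightarrow> TA t X Y f \<xi> \<in> TO t Y"
  using TA_PiE by (meson PiE_mem)

lemma TA_id: "small X \<Longrightarrow> TA t X X (restrict id X) = restrict id (TO t X)"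
  using functor_T unfolding is_functor_def Set_cat_def by simp

lemma TA_compose:
  "small X \<Longrightarrow> small Y \<Longrightarrow> small Z \<Longrightarrow> f \<in> X \<rightarrow>\<^sub>E Y \<Longrightarrow> g \<in> Y \<rightarrow>\<^sub>E Z \<Longrightarrow>
    TA t X Z (compose X g f) = compose (TO t X) (TA t Y Z g) (TA t X Y f)"
  using functor_T unfolding is_functor_def Set_cat_def by simp

lemma unt_nat: "nat_trans Set_cat Set_cat id_fctr (fct t) (unt t)"
  using monad unfolding is_monad_def by (elim conjE)

lemma mul_nat: "nat_trans Set_cat Set_cat (comp_fctr (fct t) (fct t)) (fct t) (mul t)"
  using monad unfolding is_monad_def by (elim conjE)

lemma unt_in: "small X \<Longrightarrow> x \<in> X \<Longrightarrow> unt t X x \<in> TO t X"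
  using unt_nat unfolding nat_trans_def Set_cat_def id_fctr_def by (auto dest: PiE_mem)

lemma unt_natural:
  assumes "small X" "small Y" "f \<in> X \<rightarrow>\<^sub>E Y" "x \<in> X"
  shows "TA t X Y f (unt t X x) = unt t Y (f x)"
proof -
  have "compose X (unt t Y) f = compose X (TA t X Y f) (unt t X)"
    using unt_nat assms unfolding nat_trans_def Set_cat_def id_fctr_def by simp
  from fun_cong[OF this, of x] show ?thesis using assms(4) by (simp add: compose_eq)
qed

lemma mul_in: "small X \<Longrightarrow> \<xi> \<in> TO t (TO t X) \<Longrightarrow> mul t X \<xi> \<in> TO t X"
  using mul_nat unfolding nat_trans_def Set_cat_def comp_fctr_def by (auto dest: PiE_mem)

lemma mul_natural:
  assumes "small X" "small Y" "f \<in> X \<rightarrow>\<^sub>E Y" "\<xi> \<in> TO t (TO t X)"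
  shows "mul t Y (TA t (TO t X) (TO t Y) (TA t X Y f) \<xi>) = TA t X Y f (mul t X \<xi>)"
proof -
  have "compose (TO t (TO t X)) (mul t Y) (TA t (TO t X) (TO t Y) (TA t X Y f)) =
      compose (TO t (TO t X)) (TA t X Y f) (mul t X)"
    using mul_nat assms unfolding nat_trans_def Set_cat_def comp_fctr_def by simp
  from fun_cong[OF this, of \<xi>] show ?thesis using assms(4) by (simp add: compose_eq)
qed

lemmas flat = setting[unfolded tv_setting_def flat_lax_extension_def,
  THEN conjunct2, THEN conjunct2, THEN conjunct1]

lemmas flat_single = flat[THEN conjunct1, rule_format]

lemmas ext_in_vrel = flat_single[THEN conjunct1]

lemma ext_mono:
  "small X \<Longrightarrow> small Y \<Longrightarrow> r \<in> vrel X Y \<Longrightarrow> s \<in> vrel X Y \<Longrightarrow> r \<le> s \<Longrightarrow> ext t X Y r \<le> ext t X Y s"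
  by (rule flat_single[THEN conjunct2, THEN conjunct1, rule_format])

lemmas ext_vconv = flat_single[THEN conjunct2, THEN conjunct2, THEN conjunct1]

lemmas ext_vcomp = flat[THEN conjunct2, THEN conjunct1, rule_format]

lemmas ext_vgraph = flat[THEN conjunct2, THEN conjunct2, THEN conjunct2, rule_format]

text \<open>A lax extension is strict on precomposition with a map: as \<open>T f\<^sup>\<circ>\<close> is the extension of \<open>f\<^sup>\<circ>\<close>,
  \<open>T (s \<cdot> f) \<le> T (s \<cdot> f) \<cdot> T f\<^sup>\<circ> \<cdot> T f \<le> T (s \<cdot> f \<cdot> f\<^sup>\<circ>) \<cdot> T f \<le> T s \<cdot> T f\<close>.\<close>

lemma ext_vcomp_vgraph_le:
  assumes X: "small X" and Y: "small Y" and Z: "small Z" and f: "f \<in> X \<rightarrow>\<^sub>E Y"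
    and s: "s \<in> vrel Y Z" and \<xi>: "\<xi> \<in> TO t X"
  shows "ext t X Z (s \<cdot>\<^sub>v vgraph X f) \<xi> \<zeta> \<le> ext t Y Z s (TA t X Y f \<xi>) \<zeta>"
proof -
  let ?g = "vgraph X f :: 'u \<Rightarrow> 'u \<Rightarrow> 'v"
  have g: "?g \<in> vrel X Y" using f by (intro vgraph_in_vrel) auto
  note sg = vcomp_in_vrel[OF g s] and cg = vconv_in_vrel[OF g]
  have "ext t Y X (vconv ?g) (TA t X Y f \<xi>) \<xi> = 1"
    unfolding ext_vconv[OF X Y g] unfolding vconv_def ext_vgraph[OF X Y f]
    using \<xi> by (simp add: vgraph_def)
  then have "ext t X Z (s \<cdot>\<^sub>v ?g) \<xi> \<zeta>
      \<le> (ext t X Z (s \<cdot>\<^sub>v ?g) \<cdot>\<^sub>v ext t Y X (vconv ?g)) (TA t X Y f \<xi>) \<zeta>"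
    by (metis mult_1 vcomp_upper)
  also have "\<dots> \<le> ext t Y Z ((s \<cdot>\<^sub>v ?g) \<cdot>\<^sub>v vconv ?g) (TA t X Y f \<xi>) \<zeta>"
    using ext_vcomp[OF Y X Z cg sg] by (simp add: le_fun_def)
  also have "\<dots> \<le> ext t Y Z s (TA t X Y f \<xi>) \<zeta>"
  proof -
    have "(s \<cdot>\<^sub>v ?g) \<cdot>\<^sub>v vconv ?g \<le> s"
      unfolding vcomp_le_iff vcomp_vgraph by (auto simp: vconv_def vgraph_def)
    then show ?thesis
      using ext_mono[OF Y Z vcomp_in_vrel[OF cg sg] s] by (simp add: le_fun_def)
  qed
  finally show ?thesis .
qed


section \<open>Spaces and initial structures\<close>

lemma tv_space_iff:
  "tv_space t (X, a) \<longleftrightarrow> small X \<and> a \<in> vrel (TO t X) X \<and>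
    (\<forall>x\<in>X. 1 \<le> a (unt t X x) x) \<and>
    (\<forall>\<xi>\<in>TO t (TO t X). \<forall>\<eta>\<in>TO t X. \<forall>x\<in>X.
      ext t (TO t X) X a \<xi> \<eta> * a \<eta> x \<le> a (mul t X \<xi>) x)" (is "?L \<longleftrightarrow> ?R")
proof (cases "small X \<and> a \<in> vrel (TO t X) X")
  case True
  have refl: "vgraph X id \<le> a \<cdot>\<^sub>v vgraph X (unt t X) \<longleftrightarrow> (\<forall>x\<in>X. 1 \<le> a (unt t X x) x)"
    unfolding le_fun_def vcomp_vgraph by (auto simp: vgraph_def)
  have e: "ext t (TO t X) X a \<in> vrel (TO t (TO t X)) (TO t X)"
    using True by (simp add: ext_in_vrel small_TO)
  have "a \<cdot>\<^sub>v ext t (TO t X) X a \<le> a \<cdot>\<^sub>v vgraph (TO t (TO t X)) (mul t X) \<longleftrightarrow>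
    (\<forall>\<xi>\<in>TO t (TO t X). \<forall>\<eta>\<in>TO t X. \<forall>x\<in>X.
      ext t (TO t X) X a \<xi> \<eta> * a \<eta> x \<le> a (mul t X \<xi>) x)" (is "_ \<longleftrightarrow> ?Q")
  proof
    assume L: "a \<cdot>\<^sub>v ext t (TO t X) X a \<le> a \<cdot>\<^sub>v vgraph (TO t (TO t X)) (mul t X)"
    show ?Q
    proof (intro ballI)
      fix \<xi> \<eta> x assume "\<xi> \<in> TO t (TO t X)"
      then show "ext t (TO t X) X a \<xi> \<eta> * a \<eta> x \<le> a (mul t X \<xi>) x"
        using L[unfolded vcomp_le_iff vcomp_vgraph, rule_format, of \<xi> \<eta> x] by simp
    qed
  next
    assume Q: ?Q
    show "a \<cdot>\<^sub>v ext t (TO t X) X a \<le> a \<cdot>\<^sub>v vgraph (TO t (TO t X)) (mul t X)"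
      unfolding vcomp_le_iff vcomp_vgraph
    proof (intro allI)
      fix \<xi> \<eta> x
      show "ext t (TO t X) X a \<xi> \<eta> * a \<eta> x
          \<le> (if \<xi> \<in> TO t (TO t X) then a (mul t X \<xi>) x else bot)"
      proof (cases "\<xi> \<in> TO t (TO t X) \<and> \<eta> \<in> TO t X \<and> x \<in> X")
        case False
        then have "ext t (TO t X) X a \<xi> \<eta> * a \<eta> x = bot"
          using True e by (auto simp: vrel_def)
        then show ?thesis by simp
      qed (use Q in simp)
    qed
  qed
  then show ?thesis
    using refl True unfolding tv_space_def by simp
qed (auto simp: tv_space_def)

abbreviation space :: "'u set \<times> ('u \<Rightarrow> 'u \<Rightarrow> 'v) \<Rightarrow> bool" where
  "space \<equiv> tv_space t"

text \<open>Continuity for functions with arbitrary values outside the underlying set, so that maps can be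
  written as plain lambda terms and composed as such.\<close>

definition cont :: "'u set \<times> ('u \<Rightarrow> 'u \<Rightarrow> 'v) \<Rightarrow> 'u set \<times> ('u \<Rightarrow> 'u \<Rightarrow> 'v) \<Rightarrow> ('u \<Rightarrow> 'u) \<Rightarrow> bool" where
  "cont A B f \<longleftrightarrow> tv_continuous t A B (restrict f (fst A))"

lemma tv_continuous_iff: "tv_continuous t A B f \<longleftrightarrow> cont A B f \<and> f \<in> extensional (fst A)"
proof (cases "f \<in> extensional (fst A)")
  case True
  then show ?thesis unfolding cont_def by (simp add: extensional_restrict)
next
  case False
  then show ?thesis by (auto simp: tv_continuous_def PiE_iff split: prod.splits)
qed

lemma space_small: "space A \<Longrightarrow> small (fst A)"
  by (auto simp: tv_space_def)

lemma space_vrel: "space A \<Longrightarrow> snd A \<in> vrel (TO t (fst A)) (fst A)"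
  by (auto simp: tv_space_def)

lemma cont_iff:
  assumes "space A"
  shows "cont A B f \<longleftrightarrow> f \<in> fst A \<rightarrow> fst B \<and> (\<forall>\<xi>\<in>TO t (fst A). \<forall>x\<in>fst A.
    snd A \<xi> x \<le> snd B (TA t (fst A) (fst B) (restrict f (fst A)) \<xi>) (f x))" (is "_ \<longleftrightarrow> ?R")
proof -
  obtain X a Y b where AB: "A = (X, a)" "B = (Y, b)" by fastforce
  have a: "\<And>\<xi> x. \<xi> \<notin> TO t X \<Longrightarrow> a \<xi> x = bot"
    using space_vrel[OF assms] by (simp add: AB vrel_def)
  show ?thesis
    unfolding cont_def tv_continuous_def AB
    by (auto simp: vgraph_vcomp_le_iff vcomp_vgraph a)
qed

lemma cont_mem: "cont A B f \<Longrightarrow> x \<in> fst A \<Longrightarrow> f x \<in> fst B"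
  unfolding cont_def tv_continuous_def by (auto split: prod.splits)

lemma cont_cong: "(\<And>x. x \<in> fst A \<Longrightarrow> f x = g x) \<Longrightarrow> cont A B f \<longleftrightarrow> cont A B g"
  unfolding cont_def by (simp cong: restrict_cong)

lemma cont_restrict [simp]: "cont A B (restrict f (fst A)) \<longleftrightarrow> cont A B f"
  by (rule cont_cong) simp

lemma cont_id: "space A \<Longrightarrow> cont A A (\<lambda>x. x)"
  using TA_id[of "fst A"] space_small[of A]
  by (auto simp: cont_iff id_def)

lemma cont_compose:
  assumes A: "space A" and B: "space B" and C: "space C" and f: "cont A B f" and g: "cont B C g"
  shows "cont A C (\<lambda>x. g (f x))"
proof -
  let ?X = "fst A" and ?Y = "fst B" and ?Z = "fst C"
  let ?f = "restrict f ?X" and ?g = "restrict g ?Y"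
  have fP: "?f \<in> ?X \<rightarrow>\<^sub>E ?Y" and gP: "?g \<in> ?Y \<rightarrow>\<^sub>E ?Z"
    using f g by (auto dest: cont_mem)
  note sm = space_small[OF A] space_small[OF B] space_small[OF C]
  have eq: "restrict (\<lambda>x. g (f x)) ?X = compose ?X ?g ?f"
    using f by (auto simp: compose_def fun_eq_iff dest: cont_mem)
  show ?thesis
    unfolding cont_iff[OF A]
  proof (intro conjI ballI)
    show "(\<lambda>x. g (f x)) \<in> ?X \<rightarrow> ?Z"
      using f g by (auto dest: cont_mem)
    fix \<xi> x assume \<xi>: "\<xi> \<in> TO t ?X" and x: "x \<in> ?X"
    have "snd A \<xi> x \<le> snd B (TA t ?X ?Y ?f \<xi>) (f x)"
      using f \<xi> x by (simp add: cont_iff[OF A])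
    also have "\<dots> \<le> snd C (TA t ?Y ?Z ?g (TA t ?X ?Y ?f \<xi>)) (g (f x))"
      using g x cont_mem[OF f x] TA_in[OF sm(1,2) fP \<xi>] by (simp add: cont_iff[OF B])
    also have "TA t ?Y ?Z ?g (TA t ?X ?Y ?f \<xi>) = TA t ?X ?Z (restrict (\<lambda>x. g (f x)) ?X) \<xi>"
      unfolding eq TA_compose[OF sm fP gP] using \<xi> by (simp add: compose_eq)
    finally show "snd A \<xi> x \<le> snd C (TA t ?X ?Z (restrict (\<lambda>x. g (f x)) ?X) \<xi>) (g (f x))" .
  qed
qed

lemma cont_const: "space A \<Longrightarrow> space B \<Longrightarrow> y \<in> fst B \<Longrightarrow> cont A B (\<lambda>x. y)"
  using setting unfolding tv_setting_def constants_continuous_def cont_def by blast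

text \<open>The largest relation from \<open>T X\<close> to \<open>X\<close> for which all maps of the source \<open>S\<close> are continuous. It
  has to vanish outside the sets, where the infimum need not be \<open>bot\<close>.\<close>

definition init ::
  "'u set \<Rightarrow> (('u set \<times> ('u \<Rightarrow> 'u \<Rightarrow> 'v)) \<times> ('u \<Rightarrow> 'u)) set \<Rightarrow> 'u \<Rightarrow> 'u \<Rightarrow> 'v" where
  "init X S = (\<lambda>\<xi> x. if \<xi> \<in> TO t X \<and> x \<in> X
     then (INF (B, g)\<in>S. snd B (TA t X (fst B) (restrict g X) \<xi>) (g x)) else bot)"

definition source :: "'u set \<Rightarrow> (('u set \<times> ('u \<Rightarrow> 'u \<Rightarrow> 'v)) \<times> ('u \<Rightarrow> 'u)) set \<Rightarrow> bool" where
  "source X S \<longleftrightarrow> small X \<and> (\<forall>(B, g)\<in>S. space B \<and> g \<in> X \<rightarrow> fst B)"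

lemma init_vrel: "init X S \<in> vrel (TO t X) X"
  by (auto simp: init_def vrel_def)

lemma init_le:
  assumes "(B, g) \<in> S" "\<xi> \<in> TO t X" "x \<in> X"
  shows "init X S \<xi> x \<le> snd B (TA t X (fst B) (restrict g X) \<xi>) (g x)"
  using assms by (auto simp: init_def intro!: INF_lower2)

text \<open>Each map \<open>g\<close> of the source satisfies \<open>g \<cdot> a \<le> b \<cdot> T g\<close> by the choice of \<open>a\<close>. Applying the
  extension gives \<open>T g \<cdot> T a \<le> T (g \<cdot> a) \<le> T (b \<cdot> T g) \<le> T b \<cdot> T T g\<close>, which is what transitivity
  of \<open>a\<close> requires.\<close>

lemma ext_init_le:
  assumes X: "small X" and B: "space B" and g: "g \<in> X \<rightarrow> fst B" and S: "(B, g) \<in> S"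
    and \<xi>: "\<xi> \<in> TO t (TO t X)" and \<eta>: "\<eta> \<in> TO t X"
  defines "h \<equiv> TA t X (fst B) (restrict g X)"
  shows "ext t (TO t X) X (init X S) \<xi> \<eta>
    \<le> ext t (TO t (fst B)) (fst B) (snd B) (TA t (TO t X) (TO t (fst B)) h \<xi>) (h \<eta>)"
proof -
  let ?a = "init X S" and ?Y = "fst B" and ?b = "snd B"
  let ?g = "restrict g X"
  let ?G = "vgraph X ?g :: 'u \<Rightarrow> 'u \<Rightarrow> 'v" and ?H = "vgraph (TO t X) h :: 'u \<Rightarrow> 'u \<Rightarrow> 'v"
  have gP: "?g \<in> X \<rightarrow>\<^sub>E ?Y" using g by auto
  have Y: "small ?Y" using space_small[OF B] .
  have hP: "h \<in> TO t X \<rightarrow>\<^sub>E TO t ?Y" unfolding h_def by (rule TA_PiE[OF X Y gP])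
  have G: "?G \<in> vrel X ?Y" using gP by (intro vgraph_in_vrel) auto
  have H: "?H \<in> vrel (TO t X) (TO t ?Y)" using hP by (intro vgraph_in_vrel) auto
  note TX = small_TO[OF X] and TY = small_TO[OF Y]
  have le: "?G \<cdot>\<^sub>v ?a \<le> ?b \<cdot>\<^sub>v ?H"
    unfolding vgraph_vcomp_le_iff vcomp_vgraph
    using init_le[OF S] by (auto simp: h_def) (simp add: init_def)
  have "ext t X ?Y ?G \<eta> (h \<eta>) = 1"
    unfolding ext_vgraph[OF X Y gP] h_def using \<eta> by (simp add: vgraph_def)
  then have "ext t (TO t X) X ?a \<xi> \<eta> = ext t (TO t X) X ?a \<xi> \<eta> * ext t X ?Y ?G \<eta> (h \<eta>)"
    by simp
  also have "\<dots> \<le> (ext t X ?Y ?G \<cdot>\<^sub>v ext t (TO t X) X ?a) \<xi> (h \<eta>)"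
    by (rule vcomp_upper)
  also have "\<dots> \<le> ext t (TO t X) ?Y (?G \<cdot>\<^sub>v ?a) \<xi> (h \<eta>)"
    using ext_vcomp[OF TX X Y init_vrel G] by (simp add: le_fun_def)
  also have "\<dots> \<le> ext t (TO t X) ?Y (?b \<cdot>\<^sub>v ?H) \<xi> (h \<eta>)"
    using ext_mono[OF TX Y vcomp_in_vrel[OF init_vrel G] vcomp_in_vrel[OF H space_vrel[OF B]] le]
    by (simp add: le_fun_def)
  also have "\<dots> \<le> ext t (TO t ?Y) ?Y ?b (TA t (TO t X) (TO t ?Y) h \<xi>) (h \<eta>)"
    by (rule ext_vcomp_vgraph_le[OF TX TY Y hP space_vrel[OF B] \<xi>])
  finally show ?thesis .
qed

lemma space_init:
  assumes "source X S"
  shows "space (X, init X S)"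
proof -
  have X: "small X" using assms by (simp add: source_def)
  have S: "space B \<and> g \<in> X \<rightarrow> fst B \<and> restrict g X \<in> X \<rightarrow>\<^sub>E fst B" if "(B, g) \<in> S" for B g
    using assms that by (auto simp: source_def)
  show ?thesis
    unfolding tv_space_iff
  proof (intro conjI ballI X init_vrel)
    fix x assume x: "x \<in> X"
    have "1 \<le> snd B (TA t X (fst B) (restrict g X) (unt t X x)) (g x)" if Bg: "(B, g) \<in> S" for B g
    proof -
      have B: "space B" and sB: "space (fst B, snd B)" and gx: "g x \<in> fst B"
        and gP: "restrict g X \<in> X \<rightarrow>\<^sub>E fst B" using S[OF Bg] x by auto
      have "1 \<le> snd B (unt t (fst B) (g x)) (g x)"
        using sB gx unfolding tv_space_iff by blast
      then show ?thesis
        using unt_natural[OF X space_small[OF B] gP x] x by simp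
    qed
    then show "1 \<le> init X S (unt t X x) x"
      using x unt_in[OF X x] by (auto simp: init_def intro!: INF_greatest)
  next
    fix \<xi> \<eta> x assume \<xi>: "\<xi> \<in> TO t (TO t X)" and \<eta>: "\<eta> \<in> TO t X" and x: "x \<in> X"
    have "ext t (TO t X) X (init X S) \<xi> \<eta> * init X S \<eta> x
        \<le> snd B (TA t X (fst B) (restrict g X) (mul t X \<xi>)) (g x)" if Bg: "(B, g) \<in> S" for B g
    proof -
      let ?h = "TA t X (fst B) (restrict g X)" and ?Y = "fst B"
      have B: "space B" and g: "g \<in> X \<rightarrow> ?Y" and gP: "restrict g X \<in> X \<rightarrow>\<^sub>E ?Y"
        using S[OF Bg] by auto
      have sB: "space (?Y, snd B)" using B by simp
      note Y = space_small[OF B]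
      have hP: "?h \<in> TO t X \<rightarrow>\<^sub>E TO t ?Y" by (rule TA_PiE[OF X Y gP])
      have "ext t (TO t X) X (init X S) \<xi> \<eta> * init X S \<eta> x
        \<le> ext t (TO t ?Y) ?Y (snd B) (TA t (TO t X) (TO t ?Y) ?h \<xi>) (?h \<eta>) * snd B (?h \<eta>) (g x)"
        by (intro quantale_mult_mono ext_init_le[OF X B g Bg \<xi> \<eta>] init_le[OF Bg \<eta> x])
      also have "\<dots> \<le> snd B (mul t ?Y (TA t (TO t X) (TO t ?Y) ?h \<xi>)) (g x)"
        using sB TA_in[OF small_TO[OF X] small_TO[OF Y] hP \<xi>] TA_in[OF X Y gP \<eta>] g x
        unfolding tv_space_iff by blast
      also have "\<dots> = snd B (?h (mul t X \<xi>)) (g x)"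
        by (simp add: mul_natural[OF X Y gP \<xi>])
      finally show ?thesis .
    qed
    then have "ext t (TO t X) X (init X S) \<xi> \<eta> * init X S \<eta> x
        \<le> (INF (B, g)\<in>S. snd B (TA t X (fst B) (restrict g X) (mul t X \<xi>)) (g x))"
      by (auto intro!: INF_greatest)
    also have "\<dots> = init X S (mul t X \<xi>) x"
      using x mul_in[OF X \<xi>] by (simp add: init_def)
    finally show "ext t (TO t X) X (init X S) \<xi> \<eta> * init X S \<eta> x \<le> init X S (mul t X \<xi>) x" .
  qed
qed

lemma cont_init_iff:
  assumes S: "source X S" and Z: "space Z"
  shows "cont Z (X, init X S) f \<longleftrightarrow>
    f \<in> fst Z \<rightarrow> X \<and> (\<forall>(B, g)\<in>S. cont Z B (\<lambda>z. g (f z)))" (is "_ \<longleftrightarrow> ?R")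
proof
  have proj: "cont (X, init X S) B g" if "(B, g) \<in> S" for B g
    using that S init_le[OF that] by (auto simp: cont_iff[OF space_init[OF S]] source_def)
  assume f: "cont Z (X, init X S) f"
  have "cont Z B (\<lambda>z. g (f z))" if "(B, g) \<in> S" for B g
    using that S by (intro cont_compose[OF Z space_init[OF S] _ f proj]) (auto simp: source_def)
  then show ?R using f by (auto dest: cont_mem)
next
  assume R: ?R
  have X: "small X" using S by (simp add: source_def)
  have fP: "restrict f (fst Z) \<in> fst Z \<rightarrow>\<^sub>E X" using R by auto
  note sZ = space_small[OF Z]
  show "cont Z (X, init X S) f"
    unfolding cont_iff[OF Z] fst_conv snd_conv
  proof (intro conjI ballI)
    show "f \<in> fst Z \<rightarrow> X" using R by simp
    fix \<zeta> z assume \<zeta>: "\<zeta> \<in> TO t (fst Z)" and z: "z \<in> fst Z"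
    let ?\<xi> = "TA t (fst Z) X (restrict f (fst Z)) \<zeta>"
    have "snd Z \<zeta> z \<le> snd B (TA t X (fst B) (restrict g X) ?\<xi>) (g (f z))"
      if Bg: "(B, g) \<in> S" for B g
    proof -
      have B: "space B" and g: "restrict g X \<in> X \<rightarrow>\<^sub>E fst B" and c: "cont Z B (\<lambda>z. g (f z))"
        using Bg S R by (auto simp: source_def)
      have "restrict (\<lambda>z. g (f z)) (fst Z) = compose (fst Z) (restrict g X) (restrict f (fst Z))"
        using R by (auto simp: compose_def fun_eq_iff)
      then have "TA t (fst Z) (fst B) (restrict (\<lambda>z. g (f z)) (fst Z)) \<zeta>
          = TA t X (fst B) (restrict g X) ?\<xi>"
        using \<zeta> by (simp add: TA_compose[OF sZ X space_small[OF B] fP g] compose_eq)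
      moreover have "snd Z \<zeta> z
          \<le> snd B (TA t (fst Z) (fst B) (restrict (\<lambda>z. g (f z)) (fst Z)) \<zeta>) (g (f z))"
        using c \<zeta> z by (simp add: cont_iff[OF Z])
      ultimately show ?thesis by simp
    qed
    then show "snd Z \<zeta> z \<le> init X S ?\<xi> (f z)"
      using TA_in[OF sZ X fP \<zeta>] R z by (auto simp: init_def intro!: INF_greatest)
  qed
qed


section \<open>Products of spaces\<close>

lemma obj_TV [simp]: "A \<in> obj (TV_Cat t) \<longleftrightarrow> space A"
  by (simp add: TV_Cat_def)

lemma hom_TV [simp]: "f \<in> hom (TV_Cat t) A B \<longleftrightarrow> cont A B f \<and> f \<in> extensional (fst A)"
  by (simp add: TV_Cat_def tv_continuous_iff)

lemma ide_TV [simp]: "ide (TV_Cat t) A = restrict id (fst A)"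
  by (simp add: TV_Cat_def)

lemma cmp_TV [simp]: "cmp (TV_Cat t) A B C g f = compose (fst A) g f"
  by (simp add: TV_Cat_def)

definition prod_space (infixr "\<otimes>" 75) where
  "A \<otimes> B = (pairs (fst A) (fst B), init (pairs (fst A) (fst B)) {(A, pr1), (B, pr2)})"

lemma fst_prod_space [simp]: "fst (A \<otimes> B) = pairs (fst A) (fst B)"
  by (simp add: prod_space_def)

lemma source_prod: "space A \<Longrightarrow> space B \<Longrightarrow> source (pairs (fst A) (fst B)) {(A, pr1), (B, pr2)}"
  by (auto simp: source_def small_pairs space_small elim!: pairsE)

lemma space_prod [simp]: "space A \<Longrightarrow> space B \<Longrightarrow> space (A \<otimes> B)"
  unfolding prod_space_def by (intro space_init source_prod)

lemma cont_prod_iff: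
  "space A \<Longrightarrow> space B \<Longrightarrow> space Z \<Longrightarrow> cont Z (A \<otimes> B) f \<longleftrightarrow>
    f \<in> fst Z \<rightarrow> pairs (fst A) (fst B) \<and> cont Z A (\<lambda>z. pr1 (f z)) \<and> cont Z B (\<lambda>z. pr2 (f z))"
  unfolding prod_space_def by (simp add: cont_init_iff[OF source_prod])

lemma cont_pr1: "space A \<Longrightarrow> space B \<Longrightarrow> cont (A \<otimes> B) A pr1"
  using cont_id[of "A \<otimes> B"] by (simp add: cont_prod_iff)

lemma cont_pr2: "space A \<Longrightarrow> space B \<Longrightarrow> cont (A \<otimes> B) B pr2"
  using cont_id[of "A \<otimes> B"] by (simp add: cont_prod_iff)

lemma cont_pr:
  "space A \<Longrightarrow> space B \<Longrightarrow> space Z \<Longrightarrow> cont Z A f \<Longrightarrow> cont Z B g \<Longrightarrow> cont Z (A \<otimes> B) (\<lambda>z. pr (f z) (g z))"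
  by (auto simp: cont_prod_iff dest: cont_mem)

lemma is_product_prod:
  assumes A: "space A" and B: "space B"
  defines "P \<equiv> pairs (fst A) (fst B)"
  shows "is_product (TV_Cat t) A B (A \<otimes> B) (restrict pr1 P) (restrict pr2 P)"
  unfolding is_product_def
proof (intro conjI ballI)
  show "restrict pr1 P \<in> hom (TV_Cat t) (A \<otimes> B) A" "restrict pr2 P \<in> hom (TV_Cat t) (A \<otimes> B) B"
    using cont_restrict[of "A \<otimes> B"] by (simp_all add: P_def cont_pr1 cont_pr2 A B)
next
  fix Z f g assume "Z \<in> obj (TV_Cat t)" "f \<in> hom (TV_Cat t) Z A" "g \<in> hom (TV_Cat t) Z B"
  then have Z: "space Z" and f: "cont Z A f" "f \<in> extensional (fst Z)"
    and g: "cont Z B g" "g \<in> extensional (fst Z)" by auto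
  let ?h = "restrict (\<lambda>z. pr (f z) (g z)) (fst Z)"
  show "\<exists>!h. h \<in> hom (TV_Cat t) Z (A \<otimes> B) \<and>
      cmp (TV_Cat t) Z (A \<otimes> B) A (restrict pr1 P) h = f \<and>
      cmp (TV_Cat t) Z (A \<otimes> B) B (restrict pr2 P) h = g"
  proof (rule ex1I[of _ ?h], intro conjI)
    show "?h \<in> hom (TV_Cat t) Z (A \<otimes> B)"
      by (simp add: cont_pr A B Z f g)
    show "cmp (TV_Cat t) Z (A \<otimes> B) A (restrict pr1 P) ?h = f"
      using f g by (intro extensionalityI[of _ "fst Z"])
        (auto simp: compose_eq P_def dest: cont_mem)
    show "cmp (TV_Cat t) Z (A \<otimes> B) B (restrict pr2 P) ?h = g"
      using f g by (intro extensionalityI[of _ "fst Z"])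
        (auto simp: compose_eq P_def dest: cont_mem)
  next
    fix h assume h: "h \<in> hom (TV_Cat t) Z (A \<otimes> B) \<and>
      cmp (TV_Cat t) Z (A \<otimes> B) A (restrict pr1 P) h = f \<and>
      cmp (TV_Cat t) Z (A \<otimes> B) B (restrict pr2 P) h = g"
    show "h = ?h"
    proof (rule extensionalityI[of _ "fst Z"])
      fix z assume z: "z \<in> fst Z"
      then have hz: "h z \<in> P" using h cont_mem[of Z "A \<otimes> B" h z] by (simp add: P_def)
      have "f z = pr1 (h z)" "g z = pr2 (h z)"
        using h z hz by (auto simp: compose_eq)
      then show "h z = ?h z" using hz z unfolding P_def by (auto elim!: pairsE)
    qed (use h in auto)
  qed
qed (simp_all add: A B)

definition one :: "'u set \<times> ('u \<Rightarrow> 'u \<Rightarrow> 'v)" where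
  "one = ({undefined}, init {undefined} {})"

lemma fst_one [simp]: "fst one = {undefined}"
  by (simp add: one_def)

lemma space_one [simp]: "space one"
  unfolding one_def by (intro space_init) (simp add: source_def small_singleton)

lemma cont_one: "space A \<Longrightarrow> cont A one (\<lambda>x. undefined)"
  by (rule cont_const) simp_all

text \<open>Exponentiability refers to arbitrary products. Since all maps out of the one-point space are
  continuous, any product has, up to a bijection, the pairs as its points and carries the
  initial structure for its projections; the next four lemmas say so elementwise.\<close>

lemma product_mediator:
  assumes P: "is_product (TV_Cat t) A B P p q" and Z: "space Z"
    and f: "cont Z A f" and g: "cont Z B g"
  shows "\<exists>h. cont Z P h \<and> (\<forall>z\<in>fst Z. p (h z) = f z \<and> q (h z) = g z)"
proof -
  have "\<exists>!h. h \<in> hom (TV_Cat t) Z P \<and> cmp (TV_Cat t) Z P A p h = restrict f (fst Z) \<and>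
      cmp (TV_Cat t) Z P B q h = restrict g (fst Z)"
    using P unfolding is_product_def using Z f g by (simp del: cmp_TV)
  then obtain h where h: "cont Z P h" and p: "compose (fst Z) p h = restrict f (fst Z)"
    and q: "compose (fst Z) q h = restrict g (fst Z)"
    by auto
  have "p (h z) = f z \<and> q (h z) = g z" if "z \<in> fst Z" for z
    using fun_cong[OF p, of z] fun_cong[OF q, of z] that by (simp add: compose_eq)
  with h show ?thesis by blast
qed

lemma product_point:
  assumes P: "is_product (TV_Cat t) A B P p q" and "a \<in> fst A" "b \<in> fst B"
  shows "\<exists>w\<in>fst P. p w = a \<and> q w = b"
proof -
  have "space A" "space B" using P by (auto simp: is_product_def)
  then have "cont one A (\<lambda>u. a)" "cont one B (\<lambda>u. b)"
    using assms by (auto intro!: cont_const)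
  from product_mediator[OF P space_one this] show ?thesis
    by (auto dest: cont_mem)
qed

lemma product_eqI:
  assumes P: "is_product (TV_Cat t) A B P p q" and w: "w \<in> fst P" "w' \<in> fst P"
    and eq: "p w = p w'" "q w = q w'"
  shows "w = w'"
proof -
  have sp: "space A" "space B" "space P" and pq: "cont P A p" "cont P B q"
    using P by (auto simp: is_product_def)
  let ?f = "restrict (\<lambda>u. p w) (fst one)" and ?g = "restrict (\<lambda>u. q w) (fst one)"
  let ?h = "\<lambda>w. restrict (\<lambda>u. w) (fst one)"
  let ?C = "TV_Cat t"
  have "?f \<in> hom ?C one A" "?g \<in> hom ?C one B"
    using cont_mem[OF pq(1) w(1)] cont_mem[OF pq(2) w(1)]
    by (simp_all del: fst_one add: cont_const sp)
  then have "\<exists>!h. h \<in> hom ?C one P \<and> cmp ?C one P A p h = ?f \<and> cmp ?C one P B q h = ?g"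
    using P unfolding is_product_def by (simp del: hom_TV cmp_TV fst_one)
  moreover have "?h w \<in> hom ?C one P \<and> cmp ?C one P A p (?h w) = ?f \<and> cmp ?C one P B q (?h w) = ?g"
    using w by (simp add: cont_const sp compose_def del: fst_one cong: restrict_cong)
  moreover have "?h w' \<in> hom ?C one P \<and> cmp ?C one P A p (?h w') = ?f \<and> cmp ?C one P B q (?h w') = ?g"
    using w eq by (simp add: cont_const sp compose_def del: fst_one cong: restrict_cong)
  ultimately have "?h w = ?h w'" by blast
  from fun_cong[OF this, of undefined] show ?thesis by simp
qed

lemma cont_into_product:
  assumes P: "is_product (TV_Cat t) A B P p q" and Z: "space Z" and m: "f \<in> fst Z \<rightarrow> fst P"
    and f: "cont Z A (\<lambda>z. p (f z))" and g: "cont Z B (\<lambda>z. q (f z))"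
  shows "cont Z P f"
proof -
  obtain h where h: "cont Z P h" "\<forall>z\<in>fst Z. p (h z) = p (f z) \<and> q (h z) = q (f z)"
    using product_mediator[OF P Z f g] by (elim exE conjE)
  have "h z = f z" if "z \<in> fst Z" for z
    using that h(2) m by (intro product_eqI[OF P cont_mem[OF h(1)]]) auto
  from cont_cong[OF this] h(1) show ?thesis by simp
qed


section \<open>Exponentiable spaces\<close>

text \<open>\<open>G\<close> is an exponential of \<open>Y\<close> by \<open>D\<close>, where \<open>nm h\<close> is the point of \<open>G\<close> that names the continuous
  map \<open>h\<close>. This describes the adjunction without its product functor: a family of maps
  \<open>D \<rightarrow> Y\<close> indexed by \<open>Z\<close> is continuous as a map into \<open>G\<close> iff it is jointly continuous.\<close>

definition is_exp where
  "is_exp D Y G nm \<longleftrightarrow> space G \<and> (\<forall>h. cont D Y h \<longrightarrow> nm h \<in> fst G) \<and>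
    (\<forall>Z k. space Z \<longrightarrow> (\<forall>z\<in>fst Z. cont D Y (k z)) \<longrightarrow>
      (cont Z G (\<lambda>z. nm (k z)) \<longleftrightarrow> cont (Z \<otimes> D) Y (\<lambda>w. k (pr1 w) (pr2 w))))"

text \<open>The name of \<open>h\<close> is the value of the transpose of \<open>1 \<times> D \<rightarrow> D \<rightarrow> Y\<close>. By naturality in the points
  \<open>1 \<rightarrow> Z\<close>, which are continuous because they are constant, the transpose of any continuous map on
  \<open>Z \<times> D\<close> sends \<open>z\<close> to the name of its section at \<open>z\<close> (\<open>val\<close>). Since names are injective
  (\<open>inj\<close>), a continuous map \<open>Z \<rightarrow> G\<close> with the names of a given family as values must come from
  that family.\<close>

lemma exponentiable_is_exp:
  assumes D: "exponentiable (TV_Cat t) D" and Y: "space Y"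
  shows "\<exists>G nm. is_exp D Y G nm"
proof -
  let ?C = "TV_Cat t"
  obtain F p q Gf where F: "is_product_fctr ?C D F p q" and adj: "is_right_adjoint ?C ?C F Gf"
    using D unfolding exponentiable_def by blast
  have spD: "space D" using D by (simp add: exponentiable_def)
  define G where "G = fobj Gf Y"
  have P: "is_product ?C Z D (fobj F Z) (p Z) (q Z)" if "space Z" for Z
    using F that by (simp add: is_product_fctr_def)
  have FZ: "space (fobj F Z)" and pc: "cont (fobj F Z) Z (p Z)" and qc: "cont (fobj F Z) D (q Z)"
    if "space Z" for Z
    using P[OF that] by (auto simp: is_product_def)
  have spG: "space G" and Gid: "farr Gf Y Y (restrict id (fst Y)) = restrict id (fst G)"
    using adj Y by (auto simp: is_right_adjoint_def is_functor_def G_def)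
  obtain \<phi> where
    "(\<forall>X\<in>obj ?C. \<forall>Y\<in>obj ?C. bij_betw (\<phi> X Y) (hom ?C (fobj F X) Y) (hom ?C X (fobj Gf Y))) \<and>
     (\<forall>X\<in>obj ?C. \<forall>X'\<in>obj ?C. \<forall>Y\<in>obj ?C. \<forall>Y'\<in>obj ?C.
        \<forall>f\<in>hom ?C X' X. \<forall>g\<in>hom ?C Y Y'. \<forall>h\<in>hom ?C (fobj F X) Y.
        \<phi> X' Y' (cmp ?C (fobj F X') Y Y' g (cmp ?C (fobj F X') (fobj F X) Y h (farr F X' X f))) =
        cmp ?C X' (fobj Gf Y) (fobj Gf Y') (farr Gf Y Y' g)
          (cmp ?C X' X (fobj Gf Y) (\<phi> X Y h) f))"
    using adj unfolding is_right_adjoint_def by (elim conjE exE) (rule that, rule conjI)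
  note \<phi> = this[THEN conjunct1, rule_format] this[THEN conjunct2, rule_format]
  have bij: "bij_betw (\<phi> Z Y) (hom ?C (fobj F Z) Y) (hom ?C Z G)" if "space Z" for Z
    unfolding G_def by (rule \<phi>(1)) (simp_all add: that Y)
  have nat: "\<phi> Z' Y (cmp ?C (fobj F Z') Y Y g (cmp ?C (fobj F Z') (fobj F Z) Y h (farr F Z' Z f))) =
        cmp ?C Z' G G (farr Gf Y Y g) (cmp ?C Z' Z G (\<phi> Z Y h) f)"
    if "space Z" "space Z'" "f \<in> hom ?C Z' Z" "g \<in> hom ?C Y Y" "h \<in> hom ?C (fobj F Z) Y" for Z Z' f g h
    unfolding G_def by (rule \<phi>(2)) (simp_all only: obj_TV that Y)
  have F1: "space (fobj F one)" "cont (fobj F one) one (p one)" "cont (fobj F one) D (q one)"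
    using FZ pc qc space_one by auto
  define lift where "lift h = restrict (\<lambda>w. h (q one w)) (fst (fobj F one))" for h :: "'u \<Rightarrow> 'u"
  define nm where "nm h = \<phi> one Y (lift h) undefined" for h
  have lift: "lift h \<in> hom ?C (fobj F one) Y" if "cont D Y h" for h
    using cont_compose[OF F1(1) spD Y F1(3) that] by (simp add: lift_def)
  have \<phi>_hom: "\<phi> Z Y h \<in> hom ?C Z G" if "space Z" "h \<in> hom ?C (fobj F Z) Y" for Z h
    by (rule bij_betw_apply[OF bij[OF that(1)] that(2)])
  have val: "\<phi> Z Y H z = nm (k z)"
    if Z: "space Z" and H: "H \<in> hom ?C (fobj F Z) Y" and z: "z \<in> fst Z"
      and k: "\<And>w. w \<in> fst (fobj F Z) \<Longrightarrow> H w = k (p Z w) (q Z w)" for Z H z k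
  proof -
    let ?pt = "restrict (\<lambda>u. z) (fst one)"
    let ?m = "farr F one Z ?pt"
    have pt: "?pt \<in> hom ?C one Z"
      using z Z by (simp add: cont_const del: fst_one)
    have m: "cont (fobj F one) (fobj F Z) ?m"
      and pm: "compose (fst (fobj F one)) (p Z) ?m = compose (fst (fobj F one)) ?pt (p one)"
      and qm: "compose (fst (fobj F one)) (q Z) ?m = q one"
      using F[unfolded is_product_fctr_def, THEN conjunct2, rule_format, of one Z ?pt] pt Z
      by (simp_all del: fst_one)
    have eq: "compose (fst (fobj F one)) H ?m = lift (k z)"
    proof (rule extensionalityI[of _ "fst (fobj F one)"])
      fix w assume w: "w \<in> fst (fobj F one)"
      have "p Z (?m w) = ?pt (p one w)" "q Z (?m w) = q one w"
        using fun_cong[OF pm, of w] fun_cong[OF qm, of w] w by (simp_all add: compose_eq)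
      then show "compose (fst (fobj F one)) H ?m w = lift (k z) w"
        using w k[OF cont_mem[OF m w]] cont_mem[OF F1(2) w] by (simp add: compose_eq lift_def)
    qed (auto simp: lift_def)
    have idY: "restrict id (fst Y) \<in> hom ?C Y Y"
      using cont_id[OF Y] by (simp add: id_def)
    have "cmp ?C (fobj F one) (fobj F Z) Y H ?m \<in> hom ?C (fobj F one) Y"
      using cont_compose[OF F1(1) FZ[OF Z] Y m] H by (simp add: compose_def)
    then have "compose (fst (fobj F one)) (restrict id (fst Y)) (compose (fst (fobj F one)) H ?m)
        = compose (fst (fobj F one)) H ?m"
      by (intro extensionalityI[of _ "fst (fobj F one)"]) (auto simp: compose_eq dest: cont_mem)
    then have "\<phi> one Y (lift (k z)) =
        compose (fst one) (restrict id (fst G)) (compose (fst one) (\<phi> Z Y H) ?pt)"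
      using nat[OF Z space_one pt idY H] by (simp add: Gid eq del: fst_one)
    from fun_cong[OF this, of undefined] show ?thesis
      using \<phi>_hom[OF Z H] z by (auto simp: nm_def compose_eq dest: cont_mem)
  qed
  have inj: "h d = h' d" if h: "cont D Y h" and h': "cont D Y h'" and eq: "nm h = nm h'"
    and d: "d \<in> fst D" for h h' d
  proof -
    have "\<phi> one Y (lift h) = \<phi> one Y (lift h')"
      using \<phi>_hom[OF space_one lift[OF h]] \<phi>_hom[OF space_one lift[OF h']] eq
      by (intro extensionalityI[of _ "fst one"]) (auto simp: nm_def)
    then have eq: "lift h = lift h'"
      by (rule inj_onD[OF bij_betw_imp_inj_on[OF bij[OF space_one]] _ lift[OF h] lift[OF h']])
    obtain w where "w \<in> fst (fobj F one)" "q one w = d"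
      using product_point[OF P[OF space_one], of undefined d] d by auto
    then show ?thesis
      using fun_cong[OF eq, of w] by (simp add: lift_def)
  qed
  have curry: "cont Z G (\<lambda>z. nm (k z)) \<longleftrightarrow> cont (Z \<otimes> D) Y (\<lambda>w. k (pr1 w) (pr2 w))"
    if Z: "space Z" and k: "\<forall>z\<in>fst Z. cont D Y (k z)" for Z k
  proof
    assume c: "cont (Z \<otimes> D) Y (\<lambda>w. k (pr1 w) (pr2 w))"
    let ?H = "restrict (\<lambda>w. k (p Z w) (q Z w)) (fst (fobj F Z))"
    have H: "?H \<in> hom ?C (fobj F Z) Y"
      using cont_compose[OF FZ[OF Z] space_prod[OF Z spD] Y
          cont_pr[OF Z spD FZ[OF Z] pc[OF Z] qc[OF Z]] c] by simp
    have "\<phi> Z Y ?H z = nm (k z)" if "z \<in> fst Z" for z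
      by (rule val[OF Z H that]) simp
    then show "cont Z G (\<lambda>z. nm (k z))"
      using \<phi>_hom[OF Z H] cont_cong[of Z "\<phi> Z Y ?H" "\<lambda>z. nm (k z)" G] by simp
  next
    assume "cont Z G (\<lambda>z. nm (k z))"
    then have "restrict (\<lambda>z. nm (k z)) (fst Z) \<in> hom ?C Z G" by simp
    then have "restrict (\<lambda>z. nm (k z)) (fst Z) \<in> \<phi> Z Y ` hom ?C (fobj F Z) Y"
      unfolding bij_betw_imp_surj_on[OF bij[OF Z]] .
    then obtain H where H: "H \<in> hom ?C (fobj F Z) Y"
      and \<phi>H: "\<phi> Z Y H = restrict (\<lambda>z. nm (k z)) (fst Z)"
      by (rule imageE) simp
    \<comment> \<open>the comparison map from the product of pairs to the product chosen by the functor\<close>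
    define m where "m v = (SOME w. w \<in> fst (fobj F Z) \<and> p Z w = pr1 v \<and> q Z w = pr2 v)" for v
    have m: "m v \<in> fst (fobj F Z)" "p Z (m v) = pr1 v" "q Z (m v) = pr2 v"
      if "pr1 v \<in> fst Z" "pr2 v \<in> fst D" for v
    proof -
      have "\<exists>w. w \<in> fst (fobj F Z) \<and> p Z w = pr1 v \<and> q Z w = pr2 v"
        using product_point[OF P[OF Z] that] by (simp add: Bex_def)
      from someI_ex[OF this]
      show "m v \<in> fst (fobj F Z)" "p Z (m v) = pr1 v" "q Z (m v) = pr2 v"
        by (simp_all add: m_def)
    qed
    have mc: "cont (Z \<otimes> D) (fobj F Z) m"
    proof (rule cont_into_product[OF P[OF Z] space_prod[OF Z spD]])
      show "cont (Z \<otimes> D) Z (\<lambda>v. p Z (m v))"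
        using cont_pr1[OF Z spD] by (rule cont_cong[THEN iffD1, rotated]) (auto simp: m elim!: pairsE)
      show "cont (Z \<otimes> D) D (\<lambda>v. q Z (m v))"
        using cont_pr2[OF Z spD] by (rule cont_cong[THEN iffD1, rotated]) (auto simp: m elim!: pairsE)
    qed (auto simp: m elim!: pairsE)
    have Hm: "cont (Z \<otimes> D) Y (\<lambda>v. H (m v))"
      using cont_compose[OF space_prod[OF Z spD] FZ[OF Z] Y mc] H by simp
    have "H (m (pr z d)) = k z d" if z: "z \<in> fst Z" and d: "d \<in> fst D" for z d
    proof (rule inj[OF _ _ _ d])
      show "cont D Y (\<lambda>d. H (m (pr z d)))"
        using cont_compose[OF spD space_prod[OF Z spD] Y
            cont_pr[OF Z spD spD cont_const[OF spD Z z] cont_id[OF spD]] Hm] .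
      show "cont D Y (k z)" using k z by simp
      have "\<phi> Z Y H z = nm (\<lambda>d. H (m (pr z d)))"
      proof (rule val[OF Z H z, of "\<lambda>z d. H (m (pr z d))"])
        fix w assume w: "w \<in> fst (fobj F Z)"
        have "w = m (pr (p Z w) (q Z w))"
          using w m[of "pr (p Z w) (q Z w)"] cont_mem[OF pc[OF Z] w] cont_mem[OF qc[OF Z] w]
          by (intro product_eqI[OF P[OF Z] w]) simp_all
        then show "H w = H (m (pr (p Z w) (q Z w)))" by (rule arg_cong)
      qed
      then show "nm (\<lambda>d. H (m (pr z d))) = nm (k z)"
        using z by (simp add: \<phi>H)
    qed
    then show "cont (Z \<otimes> D) Y (\<lambda>w. k (pr1 w) (pr2 w))"
      by (intro cont_cong[THEN iffD1, OF _ Hm]) (auto elim!: pairsE)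
  qed
  have nm_mem: "nm h \<in> fst G" if "cont D Y h" for h
    using \<phi>_hom[OF space_one lift[OF that]] by (auto simp: nm_def dest: cont_mem)
  show ?thesis
    unfolding is_exp_def by (intro exI[of _ G] exI[of _ nm] conjI allI impI spG nm_mem curry)
qed

end

section \<open>Generated spaces\<close>

locale tv_class = tv t for t :: "('u::set_universe, 'v::heyting_quantale) tv_data" +
  fixes \<C> :: "('u set \<times> ('u \<Rightarrow> 'u \<Rightarrow> 'v)) set"
  assumes class_space: "D \<in> \<C> \<Longrightarrow> space D"
begin

definition probewise :: "'u set \<times> ('u \<Rightarrow> 'u \<Rightarrow> 'v) \<Rightarrow> 'u set \<times> ('u \<Rightarrow> 'u \<Rightarrow> 'v) \<Rightarrow> ('u \<Rightarrow> 'u) \<Rightarrow> bool" where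
  "probewise A B g \<longleftrightarrow> (\<forall>D\<in>\<C>. \<forall>p. cont D A p \<longrightarrow> cont D B (\<lambda>d. g (p d)))"

text \<open>Being generated, with continuity of all maps at once in place of the extensional ones. The
  converse implication holds in every space, as probes can be composed with continuous maps.\<close>

definition gen :: "'u set \<times> ('u \<Rightarrow> 'u \<Rightarrow> 'v) \<Rightarrow> bool" where
  "gen A \<longleftrightarrow> space A \<and>
    (\<forall>B g. space B \<longrightarrow> g \<in> fst A \<rightarrow> fst B \<longrightarrow> probewise A B g \<longrightarrow> cont A B g)"

lemma gen_space: "gen A \<Longrightarrow> space A"
  by (simp add: gen_def)

lemma genD:
  assumes A: "gen A" and B: "space B" and g: "g \<in> fst A \<rightarrow> fst B"
    and p: "\<And>D p. D \<in> \<C> \<Longrightarrow> cont D A p \<Longrightarrow> cont D B (\<lambda>d. g (p d))"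
  shows "cont A B g"
proof -
  have "probewise A B g"
    unfolding probewise_def by (intro ballI allI impI p)
  from A[unfolded gen_def, THEN conjunct2, rule_format, OF B g this] show ?thesis .
qed

lemma probewise_cong:
  assumes "\<And>x. x \<in> fst A \<Longrightarrow> g x = g' x"
  shows "probewise A B g \<longleftrightarrow> probewise A B g'"
proof -
  have "cont D B (\<lambda>d. g (p d)) \<longleftrightarrow> cont D B (\<lambda>d. g' (p d))" if "cont D A p" for D p
    by (rule cont_cong, rule assms, rule cont_mem[OF that])
  then show ?thesis unfolding probewise_def by simp
qed

lemma generated_iff: "generated t \<C> A \<longleftrightarrow> gen A"
proof (cases "space A")
  case A: True
  have probewise_iff: "(\<forall>D p. probe t \<C> A D p \<longrightarrow> tv_continuous t D B (compose (fst D) g p))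
      \<longleftrightarrow> probewise A B g" for B g
  proof
    assume *: "\<forall>D p. probe t \<C> A D p \<longrightarrow> tv_continuous t D B (compose (fst D) g p)"
    show "probewise A B g"
      unfolding probewise_def
    proof (intro ballI allI impI)
      fix D p assume "D \<in> \<C>" "cont D A p"
      then have "probe t \<C> A D (restrict p (fst D))"
        by (simp add: probe_def tv_continuous_iff)
      from *[rule_format, OF this] have "cont D B (compose (fst D) g (restrict p (fst D)))"
        unfolding tv_continuous_iff by (rule conjunct1)
      then show "cont D B (\<lambda>d. g (p d))"
        by (rule cont_cong[THEN iffD1, rotated]) (simp add: compose_eq)
    qed
  qed (auto simp: probewise_def probe_def tv_continuous_iff compose_def)
  have forward: "probewise A B g" if "space B" "cont A B g" for B g
    unfolding probewise_def by (intro ballI allI impI cont_compose[OF class_space A that(1) _ that(2)])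
  have "generated t \<C> A \<longleftrightarrow>
    (\<forall>B. space B \<longrightarrow> (\<forall>g\<in>fst A \<rightarrow>\<^sub>E fst B. cont A B g \<longleftrightarrow> probewise A B g))"
    unfolding generated_def generated_structure_def probewise_iff
    using A by (auto simp: tv_continuous_iff PiE_iff)
  also have "\<dots> \<longleftrightarrow> gen A"
  proof
    assume *: "\<forall>B. space B \<longrightarrow> (\<forall>g\<in>fst A \<rightarrow>\<^sub>E fst B. cont A B g \<longleftrightarrow> probewise A B g)"
    have "cont A B g" if B: "space B" and g: "g \<in> fst A \<rightarrow> fst B" and p: "probewise A B g" for B g
    proof -
      have "restrict g (fst A) \<in> fst A \<rightarrow>\<^sub>E fst B" using g by auto
      moreover have "probewise A B (restrict g (fst A))"
        using p by (rule probewise_cong[THEN iffD1, rotated]) simp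
      ultimately have "cont A B (restrict g (fst A))" using * B by blast
      then show ?thesis by simp
    qed
    then show "gen A" using A by (simp add: gen_def)
  next
    assume gen: "gen A"
    show "\<forall>B. space B \<longrightarrow> (\<forall>g\<in>fst A \<rightarrow>\<^sub>E fst B. cont A B g \<longleftrightarrow> probewise A B g)"
    proof (intro allI impI ballI)
      fix B g assume B: "space B" and "g \<in> fst A \<rightarrow>\<^sub>E fst B"
      then have "g \<in> fst A \<rightarrow> fst B" by auto
      with B show "cont A B g \<longleftrightarrow> probewise A B g"
        using gen[unfolded gen_def, THEN conjunct2, rule_format, of B g] forward[of B g] by blast
    qed
  qed
  finally show ?thesis .
qed (simp add: generated_def gen_def)

text \<open>The final structure for the probes over \<open>A\<close>, obtained as the initial structure for all maps out
  of \<open>A\<close> that the probes cannot distinguish from continuous ones.\<close>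

definition coref where
  "coref A = (fst A, init (fst A) {(B, g). space B \<and> g \<in> fst A \<rightarrow> fst B \<and> probewise A B g})"

lemma fst_coref [simp]: "fst (coref A) = fst A"
  by (simp add: coref_def)

context
  fixes A assumes A: "space A"
begin

lemma source_coref: "source (fst A) {(B, g). space B \<and> g \<in> fst A \<rightarrow> fst B \<and> probewise A B g}"
  using space_small[OF A] by (simp add: source_def)

lemma space_coref: "space (coref A)"
  unfolding coref_def by (intro space_init source_coref)

lemma cont_coref: "space Z \<Longrightarrow> cont Z (coref A) f \<longleftrightarrow> f \<in> fst Z \<rightarrow> fst A \<and>
    (\<forall>B g. space B \<longrightarrow> g \<in> fst A \<rightarrow> fst B \<longrightarrow> probewise A B g \<longrightarrow> cont Z B (\<lambda>z. g (f z)))"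
  unfolding coref_def by (auto simp: cont_init_iff[OF source_coref])

lemma cont_from_coref:
  assumes "space B" "g \<in> fst A \<rightarrow> fst B" "probewise A B g"
  shows "cont (coref A) B g"
  by (rule cont_coref[OF space_coref, THEN iffD1, OF cont_id[OF space_coref],
        THEN conjunct2, rule_format, OF assms])

lemma cont_coref_id: "cont (coref A) A (\<lambda>x. x)"
  using A by (intro cont_from_coref) (auto simp: probewise_def)

lemma cont_out_of_coref: "space Z \<Longrightarrow> cont Z (coref A) f \<Longrightarrow> cont Z A f"
  by (rule cont_compose[OF _ space_coref A _ cont_coref_id])

lemma probe_coref: "D \<in> \<C> \<Longrightarrow> cont D A p \<Longrightarrow> cont D (coref A) p"
  unfolding cont_coref[OF class_space] by (auto simp: probewise_def dest: cont_mem)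

text \<open>By \<open>probe_coref\<close>, every probe over \<open>A\<close> is one over \<open>coref A\<close>.\<close>

lemma gen_coref: "gen (coref A)"
proof -
  have "probewise A B g" if "probewise (coref A) B g" for B g
    unfolding probewise_def
    by (intro ballI allI impI that[unfolded probewise_def, rule_format] probe_coref)
  then show ?thesis
    unfolding gen_def fst_coref by (intro conjI allI impI space_coref cont_from_coref)
qed

lemma cont_into_coref:
  assumes "gen X"
  shows "cont X (coref A) f \<longleftrightarrow> cont X A f"
proof
  assume f: "cont X A f"
  note X = gen_space[OF assms]
  show "cont X (coref A) f"
  proof (rule genD[OF assms space_coref])
    fix D p assume "D \<in> \<C>" "cont D X p"
    then show "cont D (coref A) (\<lambda>d. f (p d))"
      by (intro probe_coref cont_compose[OF class_space X A _ f])
  qed (use f in \<open>auto dest: cont_mem\<close>)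
qed (rule cont_out_of_coref[OF gen_space[OF assms]])

end

text \<open>Every map on a one-point space is constant.\<close>

lemma gen_one: "gen one"
proof -
  have "cont one B g" if "space B" "g \<in> {undefined} \<rightarrow> fst B" for B g
    using that by (rule_tac cont_cong[THEN iffD1, OF _ cont_const[of one B "g undefined"]]) auto
  then show ?thesis by (simp add: gen_def)
qed

end


section \<open>Function spaces\<close>

locale tv_exp_class = tv_class t \<C>
  for t :: "('u::set_universe, 'v::heyting_quantale) tv_data"
    and \<C> :: "('u set \<times> ('u \<Rightarrow> 'u \<Rightarrow> 'v)) set" +
  assumes class_exp: "D \<in> \<C> \<Longrightarrow> exponentiable (TV_Cat t) D"
    and class_prod: "D \<in> \<C> \<Longrightarrow> D' \<in> \<C> \<Longrightarrow> gen (D \<otimes> D')"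
begin

definition exp_data where
  "exp_data D Y = (SOME P. is_exp D Y (fst P) (snd P))"

lemma is_exp_data: "D \<in> \<C> \<Longrightarrow> space Y \<Longrightarrow> is_exp D Y (fst (exp_data D Y)) (snd (exp_data D Y))"
  unfolding exp_data_def
  by (rule someI_ex) (use exponentiable_is_exp[OF class_exp] in simp)

definition maps where
  "maps X Y = code (fst X) (fst Y) ` {h. cont X Y h}"

text \<open>One map for each probe \<open>p : D \<rightarrow> X\<close>: it sends the code of \<open>h\<close> to the name of \<open>h \<circ> p\<close> in the
  exponential of \<open>Y\<close> by \<open>D\<close>.\<close>

definition fun_source where
  "fun_source X Y = (\<Union>D\<in>\<C>. \<Union>p\<in>{p. cont D X p}.
    {(fst (exp_data D Y), \<lambda>e. snd (exp_data D Y) (\<lambda>d. decode (fst X) (fst Y) e (p d)))})"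

definition fun_space where
  "fun_space X Y = (maps X Y, init (maps X Y) (fun_source X Y))"

lemma fst_fun_space [simp]: "fst (fun_space X Y) = maps X Y"
  by (simp add: fun_space_def)

lemma ball_fun_source:
  "(\<forall>(B, g)\<in>fun_source X Y. P B g) \<longleftrightarrow> (\<forall>D\<in>\<C>. \<forall>p. cont D X p \<longrightarrow>
    P (fst (exp_data D Y)) (\<lambda>e. snd (exp_data D Y) (\<lambda>d. decode (fst X) (fst Y) e (p d))))"
  by (simp add: fun_source_def)

lemma mapsE:
  assumes "e \<in> maps X Y"
  obtains h where "cont X Y h" "e = code (fst X) (fst Y) h"
  using assms by (auto simp: maps_def)

context
  fixes X Y assumes X: "space X" and Y: "space Y"
begin

lemma small_maps: "small (maps X Y)"
proof (rule small_subset)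
  show "small (code (fst X) (fst Y) ` (fst X \<rightarrow>\<^sub>E fst Y))"
    using X Y by (intro small_lepoll funset_lesspoll space_small)
  show "maps X Y \<subseteq> code (fst X) (fst Y) ` (fst X \<rightarrow>\<^sub>E fst Y)"
  proof
    fix e assume "e \<in> maps X Y"
    then obtain h where h: "cont X Y h" and "e = code (fst X) (fst Y) h" by (rule mapsE)
    then have "e = code (fst X) (fst Y) (restrict h (fst X))"
      by (simp add: code_def)
    moreover have "restrict h (fst X) \<in> fst X \<rightarrow>\<^sub>E fst Y"
      using h by (auto dest: cont_mem)
    ultimately show "e \<in> code (fst X) (fst Y) ` (fst X \<rightarrow>\<^sub>E fst Y)" by blast
  qed
qed

lemma decode_code_cont:
  "cont X Y h \<Longrightarrow> x \<in> fst X \<Longrightarrow> decode (fst X) (fst Y) (code (fst X) (fst Y) h) x = h x"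
  by (rule decode_code[OF space_small[OF X] space_small[OF Y] cont_mem])

lemma cont_decode:
  assumes "e \<in> maps X Y"
  shows "cont X Y (decode (fst X) (fst Y) e)"
  using assms
proof (rule mapsE)
  fix h assume h: "cont X Y h" and e: "e = code (fst X) (fst Y) h"
  show ?thesis
    by (rule cont_cong[THEN iffD1, OF _ h]) (simp add: e decode_code_cont[OF h])
qed

lemma cont_decode_probe:
  assumes "D \<in> \<C>" "cont D X p" "e \<in> maps X Y"
  shows "cont D Y (\<lambda>d. decode (fst X) (fst Y) e (p d))"
  by (rule cont_compose[OF class_space[OF assms(1)] X Y assms(2) cont_decode[OF assms(3)]])

lemma source_fun: "source (maps X Y) (fun_source X Y)"
proof -
  have "space (fst (exp_data D Y)) \<and>
      (\<lambda>e. snd (exp_data D Y) (\<lambda>d. decode (fst X) (fst Y) e (p d))) \<in> maps X Y \<rightarrow> fst (fst (exp_data D Y))"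
    if "D \<in> \<C>" "cont D X p" for D p
    using is_exp_data[OF that(1) Y] cont_decode_probe[OF that] unfolding is_exp_def by auto
  then show ?thesis
    unfolding source_def ball_fun_source using small_maps by simp
qed

lemma space_fun: "space (fun_space X Y)"
  unfolding fun_space_def by (intro space_init source_fun)

lemma cont_fun_space_iff:
  assumes Z: "space Z" and k: "\<And>z. z \<in> fst Z \<Longrightarrow> cont X Y (k z)"
  shows "cont Z (fun_space X Y) (\<lambda>z. code (fst X) (fst Y) (k z)) \<longleftrightarrow>
    (\<forall>D\<in>\<C>. \<forall>p. cont D X p \<longrightarrow> cont (Z \<otimes> D) Y (\<lambda>w. k (pr1 w) (p (pr2 w))))"
proof -
  let ?d = "\<lambda>z. decode (fst X) (fst Y) (code (fst X) (fst Y) (k z))"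
  have maps: "code (fst X) (fst Y) (k z) \<in> maps X Y" if "z \<in> fst Z" for z
    using k[OF that] by (simp add: maps_def)
  have "cont Z (fst (exp_data D Y)) (\<lambda>z. snd (exp_data D Y) (\<lambda>d. ?d z (p d))) \<longleftrightarrow>
      cont (Z \<otimes> D) Y (\<lambda>w. k (pr1 w) (p (pr2 w)))" if D: "D \<in> \<C>" and p: "cont D X p" for D p
  proof -
    have "cont Z (fst (exp_data D Y)) (\<lambda>z. snd (exp_data D Y) (\<lambda>d. ?d z (p d))) \<longleftrightarrow>
        cont (Z \<otimes> D) Y (\<lambda>w. ?d (pr1 w) (p (pr2 w)))"
      using is_exp_data[OF D Y, unfolded is_exp_def, THEN conjunct2, THEN conjunct2, rule_format,
          of Z "\<lambda>z d. ?d z (p d)"] Z cont_decode_probe[OF D p maps] by blast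
    also have "\<dots> \<longleftrightarrow> cont (Z \<otimes> D) Y (\<lambda>w. k (pr1 w) (p (pr2 w)))"
      using cont_mem[OF p] k by (intro cont_cong) (auto simp: decode_code_cont elim!: pairsE)
    finally show ?thesis .
  qed
  then show ?thesis
    unfolding fun_space_def cont_init_iff[OF source_fun Z] ball_fun_source
    using maps by simp
qed

end

text \<open>The exponential law for generated spaces; the two directions use products \<open>D' \<otimes> D\<close> and
  diagonals \<open>D \<rightarrow> D \<otimes> D\<close> respectively, as explained at the beginning.\<close>

lemma cont_curry_iff:
  assumes A: "gen A" and X: "gen X" and Y: "space Y"
  shows "(\<forall>a\<in>fst A. cont X Y (k a)) \<and> cont A (fun_space X Y) (\<lambda>a. code (fst X) (fst Y) (k a)) \<longleftrightarrow>
    cont (coref (A \<otimes> X)) Y (\<lambda>w. k (pr1 w) (pr2 w))" (is "?L \<longleftrightarrow> ?R")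
proof
  note sA = gen_space[OF A] and sX = gen_space[OF X]
  note AX = space_prod[OF sA sX]
  note cAX = space_coref[OF AX]
  assume R: ?R
  have k: "cont X Y (k a)" if "a \<in> fst A" for a
  proof -
    have "cont X (coref (A \<otimes> X)) (\<lambda>x. pr a x)"
      unfolding cont_into_coref[OF AX X]
      by (intro cont_pr sA sX cont_const cont_id that)
    from cont_compose[OF sX cAX Y this R] show ?thesis by simp
  qed
  moreover have "cont A (fun_space X Y) (\<lambda>a. code (fst X) (fst Y) (k a))"
  proof (rule genD[OF A space_fun[OF sX Y]])
    fix D' q assume D': "D' \<in> \<C>" and q: "cont D' A q"
    note sD' = class_space[OF D']
    have kq: "cont X Y (k (q d))" if "d \<in> fst D'" for d
      using k cont_mem[OF q that] .
    show "cont D' (fun_space X Y) (\<lambda>d. code (fst X) (fst Y) (k (q d)))"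
    proof (rule cont_fun_space_iff[OF sX Y sD', THEN iffD2], rule kq, assumption,
        intro ballI allI impI)
      fix D p assume D: "D \<in> \<C>" and p: "cont D X p"
      note sD = class_space[OF D]
      note DD = space_prod[OF sD' sD]
      have "cont (D' \<otimes> D) (coref (A \<otimes> X)) (\<lambda>w. pr (q (pr1 w)) (p (pr2 w)))"
        unfolding cont_into_coref[OF AX class_prod[OF D' D]]
        by (intro cont_pr sA sX DD cont_compose[OF DD sD' sA cont_pr1 q]
            cont_compose[OF DD sD sX cont_pr2 p] sD sD')
      from cont_compose[OF DD cAX Y this R]
      show "cont (D' \<otimes> D) Y (\<lambda>w. k (q (pr1 w)) (p (pr2 w)))" by simp
    qed
  qed (use k in \<open>simp add: maps_def\<close>)
  ultimately show ?L by blast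
next
  note sA = gen_space[OF A] and sX = gen_space[OF X]
  note AX = space_prod[OF sA sX]
  assume ?L
  then have k: "\<And>a. a \<in> fst A \<Longrightarrow> cont X Y (k a)"
    and kc: "cont A (fun_space X Y) (\<lambda>a. code (fst X) (fst Y) (k a))" by auto
  show ?R
  proof (rule cont_from_coref[OF AX Y])
    show "(\<lambda>w. k (pr1 w) (pr2 w)) \<in> fst (A \<otimes> X) \<rightarrow> fst Y"
      by (auto elim!: pairsE intro: cont_mem[OF k])
    show "probewise (A \<otimes> X) Y (\<lambda>w. k (pr1 w) (pr2 w))"
      unfolding probewise_def
    proof (intro ballI allI impI)
      fix D r assume D: "D \<in> \<C>" and r: "cont D (A \<otimes> X) r"
      note sD = class_space[OF D]
      have q: "cont D A (\<lambda>d. pr1 (r d))" and p: "cont D X (\<lambda>d. pr2 (r d))"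
        using r by (simp_all add: cont_prod_iff[OF sA sX sD])
      have kq: "cont X Y (k (pr1 (r d)))" if "d \<in> fst D" for d
        using k cont_mem[OF q that] .
      have "cont D (fun_space X Y) (\<lambda>d. code (fst X) (fst Y) (k (pr1 (r d))))"
        by (rule cont_compose[OF sD sA space_fun[OF sX Y] q kc])
      then have u: "cont (D \<otimes> D) Y (\<lambda>w. k (pr1 (r (pr1 w))) (pr2 (r (pr2 w))))"
        using cont_fun_space_iff[OF sX Y sD, of "\<lambda>d. k (pr1 (r d))"] kq D p by blast
      have "cont D (D \<otimes> D) (\<lambda>d. pr d d)"
        by (intro cont_pr sD cont_id)
      from cont_compose[OF sD space_prod[OF sD sD] Y this u]
      show "cont D Y (\<lambda>d. k (pr1 (r d)) (pr2 (r d)))" by simp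
    qed
  qed
qed

end


section \<open>Cartesian closedness\<close>

context tv_exp_class
begin

abbreviation K where
  "K \<equiv> full_subcat (TV_Cat t) (generated t \<C>)"

lemma obj_K [simp]: "A \<in> obj K \<longleftrightarrow> gen A"
  using gen_space[of A] by (auto simp: full_subcat_def generated_iff)

lemma hom_K [simp]: "f \<in> hom K A B \<longleftrightarrow> cont A B f \<and> f \<in> extensional (fst A)"
  using hom_TV by (simp add: full_subcat_def)

lemma ide_K [simp]: "ide K A = restrict id (fst A)"
  using ide_TV by (simp add: full_subcat_def)

lemma cmp_K [simp]: "cmp K A B C g f = compose (fst A) g f"
  using cmp_TV by (simp add: full_subcat_def)

lemma cont_cmp:
  "gen A \<Longrightarrow> gen B \<Longrightarrow> gen C \<Longrightarrow> cont A B f \<Longrightarrow> cont B C g \<Longrightarrow> cont A C (compose (fst A) g f)"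
  unfolding compose_def cont_restrict by (rule cont_compose[OF gen_space gen_space gen_space])

lemma category_K: "category K"
  unfolding category_def
proof (intro conjI ballI)
  fix X assume "X \<in> obj K"
  then show "ide K X \<in> hom K X X"
    using cont_id[OF gen_space, of X] by (simp add: id_def)
next
  fix X Y Z f g
  assume "X \<in> obj K" "Y \<in> obj K" "Z \<in> obj K" "f \<in> hom K X Y" "g \<in> hom K Y Z"
  then show "cmp K X Y Z g f \<in> hom K X Z"
    by (simp add: cont_cmp)
next
  fix X Y f assume "f \<in> hom K X Y"
  then have f: "cont X Y f" "f \<in> extensional (fst X)" by simp_all
  show "cmp K X X Y f (ide K X) = f"
    using f(2) by (intro extensionalityI[of _ "fst X"]) (simp_all add: compose_eq)
  show "cmp K X Y Y (ide K Y) f = f"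
    using f(2) cont_mem[OF f(1)] by (intro extensionalityI[of _ "fst X"]) (simp_all add: compose_eq)
next
  fix W X Y Z f g h assume "f \<in> hom K W X"
  then have f: "cont W X f" by simp
  show "cmp K W X Z (cmp K X Y Z h g) f = cmp K W Y Z h (cmp K W X Y g f)"
    using cont_mem[OF f] by (intro extensionalityI[of _ "fst W"]) (simp_all add: compose_eq)
qed

lemma terminal_K: "is_terminal K one"
  unfolding is_terminal_def
proof (intro conjI ballI)
  show "one \<in> obj K" by (simp add: gen_one)
  fix X assume "X \<in> obj K"
  then have X: "space X" by (simp add: gen_space)
  show "\<exists>!f. f \<in> hom K X one"
  proof (rule ex1I)
    show "restrict (\<lambda>x. undefined) (fst X) \<in> hom K X one"
      unfolding hom_K cont_restrict using cont_one[OF X] by simp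
    fix f assume "f \<in> hom K X one"
    then have f: "cont X one f" "f \<in> extensional (fst X)" by simp_all
    show "f = restrict (\<lambda>x. undefined) (fst X)"
      using f(2) cont_mem[OF f(1)] by (intro extensionalityI[of _ "fst X"]) simp_all
  qed
qed

text \<open>A map from a generated space into \<open>coref (A \<otimes> B)\<close> is continuous iff it is so into \<open>A \<otimes> B\<close>, hence
  the universal property is inherited.\<close>

lemma product_K:
  assumes A: "gen A" and B: "gen B"
  defines "P \<equiv> pairs (fst A) (fst B)"
  shows "is_product K A B (coref (A \<otimes> B)) (restrict pr1 P) (restrict pr2 P)"
proof -
  note sA = gen_space[OF A] and sB = gen_space[OF B]
  note AB = space_prod[OF sA sB]
  have hom: "hom K Z (coref (A \<otimes> B)) = hom (TV_Cat t) Z (A \<otimes> B)" if "gen Z" for Z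
    using cont_into_coref[OF AB that] by (intro set_eqI) (simp only: hom_K hom_TV)
  note TV = is_product_prod[OF sA sB, folded P_def, unfolded is_product_def]
  show ?thesis
    unfolding is_product_def
  proof (intro conjI ballI)
    have "cont (coref (A \<otimes> B)) A pr1" "cont (coref (A \<otimes> B)) B pr2"
      using cont_compose[OF space_coref[OF AB] AB sA cont_coref_id[OF AB] cont_pr1[OF sA sB]]
        cont_compose[OF space_coref[OF AB] AB sB cont_coref_id[OF AB] cont_pr2[OF sA sB]] by simp_all
    then show "restrict pr1 P \<in> hom K (coref (A \<otimes> B)) A" "restrict pr2 P \<in> hom K (coref (A \<otimes> B)) B"
      using cont_restrict[of "coref (A \<otimes> B)"] by (simp_all add: P_def)
  next
    fix Z f g assume Z: "Z \<in> obj K" and "f \<in> hom K Z A" "g \<in> hom K Z B"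
    then have "gen Z" "Z \<in> obj (TV_Cat t)" "f \<in> hom (TV_Cat t) Z A" "g \<in> hom (TV_Cat t) Z B"
      using gen_space[of Z] by simp_all
    then show "\<exists>!h. h \<in> hom K Z (coref (A \<otimes> B)) \<and>
        cmp K Z (coref (A \<otimes> B)) A (restrict pr1 P) h = f \<and>
        cmp K Z (coref (A \<otimes> B)) B (restrict pr2 P) h = g"
      using TV[THEN conjunct2, THEN conjunct2, THEN conjunct2, THEN conjunct2, THEN conjunct2,
          rule_format, of Z f g] by (simp only: hom cmp_K cmp_TV)
  qed (simp_all add: A B gen_coref[OF AB])
qed

context
  fixes X assumes X: "gen X"
begin

definition times_space :: "('u set \<times> ('u \<Rightarrow> 'u \<Rightarrow> 'v)) \<Rightarrow> ('u set \<times> ('u \<Rightarrow> 'u \<Rightarrow> 'v))" where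
  "times_space A = coref (A \<otimes> X)"

definition power_space :: "('u set \<times> ('u \<Rightarrow> 'u \<Rightarrow> 'v)) \<Rightarrow> ('u set \<times> ('u \<Rightarrow> 'u \<Rightarrow> 'v))" where
  "power_space Y = coref (fun_space X Y)"

lemma fst_times [simp]: "fst (times_space A) = pairs (fst A) (fst X)"
  by (simp add: times_space_def)

lemma fst_power [simp]: "fst (power_space Y) = maps X Y"
  by (simp add: power_space_def)

lemma sX: "space X"
  by (rule gen_space[OF X])

lemma gen_times: "gen A \<Longrightarrow> gen (times_space A)"
  unfolding times_space_def by (intro gen_coref space_prod sX gen_space)

lemma gen_power: "gen Y \<Longrightarrow> gen (power_space Y)"
  unfolding power_space_def by (intro gen_coref space_fun sX gen_space)

lemma cont_into_times: "gen A \<Longrightarrow> gen Z \<Longrightarrow> cont Z (times_space A) f \<longleftrightarrow> cont Z (A \<otimes> X) f"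
  unfolding times_space_def by (intro cont_into_coref space_prod sX gen_space)

lemma cont_into_power: "gen Y \<Longrightarrow> gen Z \<Longrightarrow> cont Z (power_space Y) f \<longleftrightarrow> cont Z (fun_space X Y) f"
  unfolding power_space_def by (intro cont_into_coref space_fun sX gen_space)

lemma cont_times_map:
  assumes A: "gen A" and B: "gen B" and f: "cont A B f"
  shows "cont (times_space A) (times_space B) (\<lambda>w. pr (f (pr1 w)) (pr2 w))"
proof -
  note sA = gen_space[OF A] and sB = gen_space[OF B] and sT = gen_space[OF gen_times[OF A]]
  have "cont (times_space A) (A \<otimes> X) (\<lambda>w. w)"
    unfolding cont_into_times[OF A gen_times[OF A], symmetric] by (rule cont_id[OF sT])
  then have 1: "cont (times_space A) A pr1" and 2: "cont (times_space A) X pr2"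
    by (simp_all add: cont_prod_iff sA sX sT)
  show ?thesis
    unfolding cont_into_times[OF B gen_times[OF A]]
    by (rule cont_pr[OF sB sX sT cont_compose[OF sT sA sB 1 f] 2])
qed

lemma code_decode:
  assumes Y: "gen Y" and e: "e \<in> maps X Y"
  shows "code (fst X) (fst Y) (decode (fst X) (fst Y) e) = e"
  using e
proof (rule mapsE)
  fix h assume h: "cont X Y h" and eq: "e = code (fst X) (fst Y) h"
  show ?thesis
    unfolding eq by (rule code_cong) (rule decode_code_cont[OF sX gen_space[OF Y] h])
qed

lemma cont_uncurry:
  assumes A: "gen A" and Y: "gen Y" and n: "cont A (power_space Y) n"
  shows "cont (times_space A) Y (\<lambda>w. decode (fst X) (fst Y) (n (pr1 w)) (pr2 w))"
proof -
  have n_mem: "n a \<in> maps X Y" if "a \<in> fst A" for a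
    using cont_mem[OF n that] by simp
  have "cont A (fun_space X Y) (\<lambda>a. code (fst X) (fst Y) (decode (fst X) (fst Y) (n a)))"
    by (rule cont_cong[THEN iffD1, OF _ n[unfolded cont_into_power[OF Y A]]])
      (simp add: code_decode[OF Y] n_mem)
  then show ?thesis
    unfolding times_space_def
    by (intro cont_curry_iff[OF A X gen_space[OF Y], THEN iffD1] conjI ballI
        cont_decode[OF sX gen_space[OF Y]] n_mem)
qed

lemma cont_curry:
  assumes A: "gen A" and Y: "gen Y" and h: "cont (times_space A) Y h"
  shows "a \<in> fst A \<Longrightarrow> cont X Y (\<lambda>x. h (pr a x))"
    and "cont A (power_space Y) (\<lambda>a. code (fst X) (fst Y) (\<lambda>x. h (pr a x)))"
proof -
  have "cont (times_space A) Y (\<lambda>w. h (pr (pr1 w) (pr2 w)))"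
    by (rule cont_cong[THEN iffD1, OF _ h]) (auto elim!: pairsE)
  from cont_curry_iff[OF A X gen_space[OF Y], THEN iffD2, of "\<lambda>a x. h (pr a x)",
      OF this[unfolded times_space_def]]
  show "a \<in> fst A \<Longrightarrow> cont X Y (\<lambda>x. h (pr a x))"
    and "cont A (power_space Y) (\<lambda>a. code (fst X) (fst Y) (\<lambda>x. h (pr a x)))"
    unfolding cont_into_power[OF Y A] by blast+
qed

text \<open>Functoriality of the exponential is obtained from currying: the map is the transpose of the
  evaluation followed by \<open>g\<close>.\<close>

lemma cont_power_map:
  assumes Y: "gen Y" and Z: "gen Z" and g: "cont Y Z g"
  shows "cont (power_space Y) (power_space Z)
    (\<lambda>e. code (fst X) (fst Z) (\<lambda>x. g (decode (fst X) (fst Y) e x)))"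
proof -
  note G = gen_power[OF Y]
  have "cont (times_space (power_space Y)) Y (\<lambda>w. decode (fst X) (fst Y) (pr1 w) (pr2 w))"
    by (rule cont_uncurry[OF G Y cont_id[OF gen_space[OF G]]])
  from cont_compose[OF gen_space[OF gen_times[OF G]] gen_space[OF Y] gen_space[OF Z] this g]
  have "cont (times_space (power_space Y)) Z (\<lambda>w. g (decode (fst X) (fst Y) (pr1 w) (pr2 w)))" .
  from cont_curry(2)[OF G Z this] show ?thesis by simp
qed

definition times_fctr where
  "times_fctr = \<lparr>fobj = times_space,
    farr = \<lambda>A B f. restrict (\<lambda>w. pr (f (pr1 w)) (pr2 w)) (pairs (fst A) (fst X))\<rparr>"

definition power_fctr where
  "power_fctr = \<lparr>fobj = power_space,
    farr = \<lambda>Y Z g. restrict (\<lambda>e. code (fst X) (fst Z) (\<lambda>x. g (decode (fst X) (fst Y) e x))) (maps X Y)\<rparr>"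

lemma times_fctr_simps [simp]:
  "fobj times_fctr = times_space"
  "farr times_fctr A B f = restrict (\<lambda>w. pr (f (pr1 w)) (pr2 w)) (pairs (fst A) (fst X))"
  by (simp_all add: times_fctr_def)

lemma power_fctr_simps [simp]:
  "fobj power_fctr = power_space"
  "farr power_fctr Y Z g =
    restrict (\<lambda>e. code (fst X) (fst Z) (\<lambda>x. g (decode (fst X) (fst Y) e x))) (maps X Y)"
  by (simp_all add: power_fctr_def)

lemma times_map_hom:
  assumes "gen A" "gen B" "cont A B f"
  shows "farr times_fctr A B f \<in> hom K (times_space A) (times_space B)"
  using cont_times_map[OF assms] cont_restrict[of "times_space A" "times_space B"] by simp

lemma power_map_hom:
  assumes "gen Y" "gen Z" "cont Y Z g"
  shows "farr power_fctr Y Z g \<in> hom K (power_space Y) (power_space Z)"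
  using cont_power_map[OF assms] cont_restrict[of "power_space Y" "power_space Z"] by simp

lemma is_functor_times: "is_functor K K times_fctr"
  unfolding is_functor_def
proof (intro conjI ballI)
  fix A assume "A \<in> obj K"
  then show "fobj times_fctr A \<in> obj K" by (simp add: gen_times)
next
  fix A B f assume "A \<in> obj K" "B \<in> obj K" "f \<in> hom K A B"
  then show "farr times_fctr A B f \<in> hom K (fobj times_fctr A) (fobj times_fctr B)"
    using times_map_hom[of A B f] by simp
next
  fix A
  show "farr times_fctr A A (ide K A) = ide K (fobj times_fctr A)"
    by (rule extensionalityI[of _ "pairs (fst A) (fst X)"]) (auto elim!: pairsE)
next
  fix A B C f g assume "f \<in> hom K A B"
  then have f: "cont A B f" by simp
  show "farr times_fctr A C (cmp K A B C g f) =
    cmp K (fobj times_fctr A) (fobj times_fctr B) (fobj times_fctr C)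
      (farr times_fctr B C g) (farr times_fctr A B f)"
    by (rule extensionalityI[of _ "pairs (fst A) (fst X)"])
      (auto elim!: pairsE simp: compose_eq cont_mem[OF f])
qed

lemma is_functor_power: "is_functor K K power_fctr"
  unfolding is_functor_def
proof (intro conjI ballI)
  fix Y assume "Y \<in> obj K"
  then show "fobj power_fctr Y \<in> obj K" by (simp add: gen_power)
next
  fix Y Z g assume "Y \<in> obj K" "Z \<in> obj K" "g \<in> hom K Y Z"
  then show "farr power_fctr Y Z g \<in> hom K (fobj power_fctr Y) (fobj power_fctr Z)"
    using power_map_hom[of Y Z g] by simp
next
  fix Y assume "Y \<in> obj K"
  then have Y: "gen Y" by simp
  have "code (fst X) (fst Y) (\<lambda>x. restrict id (fst Y) (decode (fst X) (fst Y) e x)) = e"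
    if e: "e \<in> maps X Y" for e
  proof -
    have "code (fst X) (fst Y) (\<lambda>x. restrict id (fst Y) (decode (fst X) (fst Y) e x)) =
        code (fst X) (fst Y) (decode (fst X) (fst Y) e)"
      by (rule code_cong) (simp add: cont_mem[OF cont_decode[OF sX gen_space[OF Y] e]])
    then show ?thesis by (simp add: code_decode[OF Y e])
  qed
  then show "farr power_fctr Y Y (ide K Y) = ide K (fobj power_fctr Y)"
    by (intro extensionalityI[of _ "maps X Y"]) simp_all
next
  fix W Y Z f g assume "W \<in> obj K" "Y \<in> obj K" "f \<in> hom K W Y" "g \<in> hom K Y Z"
  then have W: "space W" and Y: "space Y" and f: "cont W Y f"
    by (simp_all add: gen_space)
  have "code (fst X) (fst Z) (\<lambda>x. compose (fst W) g f (decode (fst X) (fst W) e x)) =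
      code (fst X) (fst Z) (\<lambda>x. g (decode (fst X) (fst Y)
        (code (fst X) (fst Y) (\<lambda>x. f (decode (fst X) (fst W) e x))) x))"
    and "code (fst X) (fst Y) (\<lambda>x. f (decode (fst X) (fst W) e x)) \<in> maps X Y"
    if e: "e \<in> maps X W" for e
  proof -
    note d = cont_decode[OF sX W e]
    note fd = cont_compose[OF sX W Y d f]
    show "code (fst X) (fst Y) (\<lambda>x. f (decode (fst X) (fst W) e x)) \<in> maps X Y"
      unfolding maps_def using fd by blast
    show "code (fst X) (fst Z) (\<lambda>x. compose (fst W) g f (decode (fst X) (fst W) e x)) =
      code (fst X) (fst Z) (\<lambda>x. g (decode (fst X) (fst Y)
        (code (fst X) (fst Y) (\<lambda>x. f (decode (fst X) (fst W) e x))) x))"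
      by (rule code_cong) (simp add: decode_code_cont[OF sX Y fd] compose_eq cont_mem[OF d])
  qed
  then show "farr power_fctr W Z (cmp K W Y Z g f) =
    cmp K (fobj power_fctr W) (fobj power_fctr Y) (fobj power_fctr Z)
      (farr power_fctr Y Z g) (farr power_fctr W Y f)"
    by (intro extensionalityI[of _ "maps X W"]) (simp_all add: compose_eq)
qed

lemma is_product_fctr_times:
  "is_product_fctr K X times_fctr
    (\<lambda>A. restrict pr1 (pairs (fst A) (fst X))) (\<lambda>A. restrict pr2 (pairs (fst A) (fst X)))"
  unfolding is_product_fctr_def
proof (intro conjI ballI)
  fix A assume "A \<in> obj K"
  then have "gen A" by simp
  from product_K[OF this X]
  show "is_product K A X (fobj times_fctr A)
      (restrict pr1 (pairs (fst A) (fst X))) (restrict pr2 (pairs (fst A) (fst X)))"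
    by (simp add: times_space_def)
next
  fix A B f assume "A \<in> obj K" "B \<in> obj K" "f \<in> hom K A B"
  then have A: "gen A" and B: "gen B" and f: "cont A B f" by simp_all
  show "farr times_fctr A B f \<in> hom K (fobj times_fctr A) (fobj times_fctr B)"
    using times_map_hom[OF A B f] by simp
  show "cmp K (fobj times_fctr A) (fobj times_fctr B) B (restrict pr1 (pairs (fst B) (fst X)))
      (farr times_fctr A B f) =
    cmp K (fobj times_fctr A) A B f (restrict pr1 (pairs (fst A) (fst X)))"
    by (rule extensionalityI[of _ "pairs (fst A) (fst X)"])
      (auto elim!: pairsE simp: compose_eq cont_mem[OF f])
  show "cmp K (fobj times_fctr A) (fobj times_fctr B) X (restrict pr2 (pairs (fst B) (fst X)))
      (farr times_fctr A B f) = restrict pr2 (pairs (fst A) (fst X))"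
    by (rule extensionalityI[of _ "pairs (fst A) (fst X)"])
      (auto elim!: pairsE simp: compose_eq cont_mem[OF f])
qed

definition curry_map :: "('u set \<times> ('u \<Rightarrow> 'u \<Rightarrow> 'v)) \<Rightarrow> ('u set \<times> ('u \<Rightarrow> 'u \<Rightarrow> 'v)) \<Rightarrow> ('u \<Rightarrow> 'u) \<Rightarrow> 'u \<Rightarrow> 'u" where
  "curry_map A Y h = restrict (\<lambda>a. code (fst X) (fst Y) (\<lambda>x. h (pr a x))) (fst A)"

lemma bij_curry_map:
  assumes A: "gen A" and Y: "gen Y"
  shows "bij_betw (curry_map A Y) (hom K (times_space A) Y) (hom K A (power_space Y))"
proof (rule bij_betwI)
  let ?\<psi> = "\<lambda>n. restrict (\<lambda>w. decode (fst X) (fst Y) (n (pr1 w)) (pr2 w)) (fst (times_space A))"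
  show "curry_map A Y \<in> hom K (times_space A) Y \<rightarrow> hom K A (power_space Y)"
  proof
    fix h assume "h \<in> hom K (times_space A) Y"
    then have "cont (times_space A) Y h" by simp
    from cont_curry(2)[OF A Y this] show "curry_map A Y h \<in> hom K A (power_space Y)"
      by (simp add: curry_map_def)
  qed
  show "?\<psi> \<in> hom K A (power_space Y) \<rightarrow> hom K (times_space A) Y"
  proof
    fix n assume "n \<in> hom K A (power_space Y)"
    then have "cont A (power_space Y) n" by simp
    from cont_uncurry[OF A Y this] show "?\<psi> n \<in> hom K (times_space A) Y"
      unfolding hom_K cont_restrict by simp
  qed
  show "?\<psi> (curry_map A Y h) = h" if "h \<in> hom K (times_space A) Y" for h
  proof (rule extensionalityI[of _ "fst (times_space A)"])
    show "h \<in> extensional (fst (times_space A))" using that by simp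
    fix w assume w: "w \<in> fst (times_space A)"
    then obtain a x where ax: "a \<in> fst A" "x \<in> fst X" "w = pr a x" by (auto elim: pairsE)
    have "cont X Y (\<lambda>x. h (pr a x))"
      using that by (intro cont_curry(1)[OF A Y] ax) simp
    from decode_code_cont[OF sX gen_space[OF Y] this ax(2)]
    show "?\<psi> (curry_map A Y h) w = h w"
      using ax by (simp add: curry_map_def)
  qed simp
  show "curry_map A Y (?\<psi> n) = n" if "n \<in> hom K A (power_space Y)" for n
  proof (rule extensionalityI[of _ "fst A"])
    show "n \<in> extensional (fst A)" using that by simp
    fix a assume a: "a \<in> fst A"
    have na: "n a \<in> maps X Y"
      using that cont_mem[of A "power_space Y" n a] a by simp
    have "code (fst X) (fst Y) (\<lambda>x. ?\<psi> n (pr a x)) = code (fst X) (fst Y) (decode (fst X) (fst Y) (n a))"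
      by (rule code_cong) (simp add: a)
    then show "curry_map A Y (?\<psi> n) a = n a"
      using a by (simp add: curry_map_def code_decode[OF Y na])
  qed (simp add: curry_map_def)
qed

lemma curry_map_natural:
  assumes A: "gen A" and A': "gen A'" and Y: "gen Y" and Y': "gen Y'"
    and f: "cont A' A f" and g: "cont Y Y' g" and h: "cont (times_space A) Y h"
  shows "curry_map A' Y' (compose (fst (times_space A')) g (compose (fst (times_space A')) h (farr times_fctr A' A f))) =
    compose (fst A') (farr power_fctr Y Y' g) (compose (fst A') (curry_map A Y h) f)"
proof (rule extensionalityI[of _ "fst A'"])
  fix a assume a: "a \<in> fst A'"
  note fa = cont_mem[OF f a]
  note hc = cont_curry(1)[OF A Y h fa]
  have mem: "code (fst X) (fst Y) (\<lambda>x. h (pr (f a) x)) \<in> maps X Y"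
    unfolding maps_def using hc by blast
  have "code (fst X) (fst Y') (\<lambda>x. compose (fst (times_space A')) g
      (compose (fst (times_space A')) h (farr times_fctr A' A f)) (pr a x)) =
    code (fst X) (fst Y') (\<lambda>x. g (decode (fst X) (fst Y)
      (code (fst X) (fst Y) (\<lambda>x. h (pr (f a) x))) x))"
    by (rule code_cong)
      (simp add: a compose_eq decode_code_cont[OF sX gen_space[OF Y] hc])
  then show "curry_map A' Y' (compose (fst (times_space A')) g
      (compose (fst (times_space A')) h (farr times_fctr A' A f))) a =
    compose (fst A') (farr power_fctr Y Y' g) (compose (fst A') (curry_map A Y h) f) a"
    using a fa mem by (simp add: curry_map_def compose_eq)
qed (simp_all add: curry_map_def)

lemma is_right_adjoint_power: "is_right_adjoint K K times_fctr power_fctr"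
  unfolding is_right_adjoint_def
proof (intro conjI exI[of _ curry_map] ballI is_functor_times is_functor_power)
  fix A Y assume "A \<in> obj K" "Y \<in> obj K"
  then show "bij_betw (curry_map A Y) (hom K (fobj times_fctr A) Y) (hom K A (fobj power_fctr Y))"
    using bij_curry_map[of A Y] by simp
next
  fix A A' Y Y' f g h
  assume "A \<in> obj K" "A' \<in> obj K" "Y \<in> obj K" "Y' \<in> obj K" "f \<in> hom K A' A"
    "g \<in> hom K Y Y'" "h \<in> hom K (fobj times_fctr A) Y"
  then show "curry_map A' Y' (cmp K (fobj times_fctr A') Y Y' g
      (cmp K (fobj times_fctr A') (fobj times_fctr A) Y h (farr times_fctr A' A f))) =
    cmp K A' (fobj power_fctr Y) (fobj power_fctr Y') (farr power_fctr Y Y' g)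
      (cmp K A' A (fobj power_fctr Y) (curry_map A Y h) f)"
    unfolding cmp_K times_fctr_simps(1) by (intro curry_map_natural) simp_all
qed

lemma exponentiable_K: "exponentiable K X"
  unfolding exponentiable_def
  using X is_product_fctr_times is_right_adjoint_power obj_K by blast

end

lemma cartesian_closed_K: "cartesian_closed K"
  unfolding cartesian_closed_def
  using category_K terminal_K product_K exponentiable_K obj_K by blast

end

theorem mainTheorem1:
  fixes t :: "('u::set_universe, 'v::heyting_quantale) tv_data"
    and \<C> :: "('u set \<times> ('u \<Rightarrow> 'u \<Rightarrow> 'v)) set"
  assumes "tv_setting t"
    and "\<C> \<subseteq> obj (TV_Cat t)"
    and "\<exists>A\<in>\<C>. fst A \<noteq> {}"
    and "\<And>A. A \<in> \<C> \<Longrightarrow> exponentiable (TV_Cat t) A"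
    and "\<And>A B P p q. A \<in> \<C> \<Longrightarrow> B \<in> \<C> \<Longrightarrow> is_product (TV_Cat t) A B P p q \<Longrightarrow> generated t \<C> P"
  shows 
    "cartesian_closed (full_subcat (TV_Cat t) (generated t \<C>))"
proof -
  interpret tv t by unfold_locales (rule assms(1))
  interpret tv_class t \<C>
    using assms(2) by unfold_locales auto
  have "gen (D \<otimes> D')" if "D \<in> \<C>" "D' \<in> \<C>" for D D'
    using assms(5)[OF that is_product_prod] that class_space generated_iff by simp
  then interpret tv_exp_class t \<C>
    using assms(4) by unfold_locales
  show ?thesis by (rule cartesian_closed_K)
qed

end
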